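(* Let $(X,d)$ be a nonempty compact metric space. If $(\mathcal{U}_{4\epsilon_n}(A_n),q_{n,n+1})$ and $(\mathcal{U}_{4\delta_n}(B_n),q_{n,n+1})$ are two FASOs for $X$ (each with its own bonding maps), then they are isomorphic as objects of pro-$HTop$.
   Context: For $\epsilon>0$, a finite subset $A\subseteq X$ is an $\epsilon$-approximation of $X$ if for every $x\in X$ there is $a\in A$ with $d(x,a)<\epsilon$. $\mathcal{B}(x,\epsilon)$ is the open ball. For an $\epsilon$-approximation $A$, $\mathcal{U}_{4\epsilon}(A)$ is the finite set of all nonempty $C\subseteq A$ with $\mathrm{diam}(C)<4\epsilon$, ordered by $C\leq D$ iff $D\subseteq C$, with the topology whose open sets are the lower sets of $\leq$ (the minimal open neighborhood of $C$ is $\{D : C\subseteq D\}$). A FASO (finite approximative sequence with opposite order) for $X$ is an inverse sequence $(\mathcal{U}_{4\epsilon_n}(A_n),q_{n,n+1})_{n\in\mathbb{N}}$, $\mathbb{N}=\{1,2,\dots\}$, where $\epsilon_1>\mathrm{diam}(X)$, each $A_n$ is an $\epsilon_n$-approximation of $X$ ($A_1$ may be a single point), $\gamma_n=\sup\{d(x,A_n) : x\in X\}$, $0<\epsilon_{n+1}<\frac{\epsilon_n-\gamma_n}{2}$ for all $n$, and $q_{n,n+1}:\mathcal{U}_{4\epsilon_{n+1}}(A_{n+1})\to\mathcal{U}_{4\epsilon_n}(A_n)$, $q_{n,n+1}(C)=\bigcup_{x\in C}\mathcal{B}(x,\epsilon_n)\cap A_n$ (these maps are well-defined and continuous). $HTop$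 is the category of topological spaces and homotopy classes of continuous maps. For a category $\mathcal{C}$, the category pro-$\mathcal{C}$ has as objects inverse systems in $\mathcal{C}$ over directed sets. A morphism of systems $(X_\lambda,p_{\lambda,\lambda'},\Lambda)\to(Y_\mu,r_{\mu,\mu'},M)$ is a function $\phi:M\to\Lambda$ with morphisms $f_\mu:X_{\phi(\mu)}\to Y_\mu$ such that for $\mu\leq\mu'$ there is $\lambda\geq\phi(\mu),\phi(\mu')$ with $f_\mu\circ p_{\phi(\mu),\lambda}=r_{\mu,\mu'}\circ f_{\mu'}\circ p_{\phi(\mu'),\lambda}$; two such, $(f_\mu,\phi)$ and $(f'_\mu,\phi')$, are equivalent if each $\mu$ admits $\lambda\geq\phi(\mu),\phi'(\mu)$ with $f_\mu\circ p_{\phi(\mu),\lambda}=f'_\mu\circ p_{\phi'(\mu),\lambda}$. Morphisms of pro-$\mathcal{C}$ are equivalence classes; composition is $(g_\nu,\psi)\circ(f_\mu,\phi)=(g_\nu\circ f_{\psi(\nu)},\phi\circ\psi)$. An inverse sequence of spaces is regarded as an object of pro-$HTop$ by passing to homotopy classes of bonding maps. *)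

theory Defs
  imports "HOL-Analysis.Analysis"
begin

section \<open>Categories\<close>

text \<open>
  Categories are presented by hom-sets. The hom-sets of different pairs of objects need not be
  disjoint, so composition takes the three objects involved as arguments:
  \<open>Compose C X Y Z g f\<close> is the composite of \<open>f \<in> Hom C X Y\<close> and \<open>g \<in> Hom C Y Z\<close>.
\<close>

record ('o, 'm) cat =
  Obj :: "'o set"
  Hom :: "'o \<Rightarrow> 'o \<Rightarrow> 'm set"
  Ident :: "'o \<Rightarrow> 'm"
  Compose :: "'o \<Rightarrow> 'o \<Rightarrow> 'o \<Rightarrow> 'm \<Rightarrow> 'm \<Rightarrow> 'm"

locale category =
  fixes C :: "('o, 'm) cat"
  assumes ident: "X \<in> Obj C \<Longrightarrow> Ident C X \<in> Hom C X X"
    and comp: "\<lbrakk>X \<in> Obj C; Y \<in> Obj C; Z \<in> Obj C; f \<in> Hom C X Y; g \<in> Hom C Y Z\<rbrakk>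
      \<Longrightarrow> Compose C X Y Z g f \<in> Hom C X Z"
    and ident_left: "\<lbrakk>X \<in> Obj C; Y \<in> Obj C; f \<in> Hom C X Y\<rbrakk>
      \<Longrightarrow> Compose C X Y Y (Ident C Y) f = f"
    and ident_right: "\<lbrakk>X \<in> Obj C; Y \<in> Obj C; f \<in> Hom C X Y\<rbrakk>
      \<Longrightarrow> Compose C X X Y f (Ident C X) = f"
    and assoc: "\<lbrakk>W \<in> Obj C; X \<in> Obj C; Y \<in> Obj C; Z \<in> Obj C;
        f \<in> Hom C W X; g \<in> Hom C X Y; h \<in> Hom C Y Z\<rbrakk>
      \<Longrightarrow> Compose C W X Z (Compose C X Y Z h g) f = Compose C W Y Z h (Compose C W X Y g f)"

definition isomorphic :: "('o, 'm) cat \<Rightarrow> 'o \<Rightarrow> 'o \<Rightarrow> bool" where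
  "isomorphic C X Y \<longleftrightarrow> X \<in> Obj C \<and> Y \<in> Obj C \<and>
     (\<exists>f\<in>Hom C X Y. \<exists>g\<in>Hom C Y X.
        Compose C X Y X g f = Ident C X \<and> Compose C Y X Y f g = Ident C Y)"


section \<open>The homotopy category of topological spaces\<close>

definition homotopy_rel :: "'a topology \<Rightarrow> 'b topology \<Rightarrow> (('a \<Rightarrow> 'b) \<times> ('a \<Rightarrow> 'b)) set" where
  "homotopy_rel X Y = {(f, g). homotopic_with (\<lambda>_. True) X Y f g}"

definition homotopy_class :: "'a topology \<Rightarrow> 'b topology \<Rightarrow> ('a \<Rightarrow> 'b) \<Rightarrow> ('a \<Rightarrow> 'b) set" where
  "homotopy_class X Y f = homotopy_rel X Y `` {f}"

text \<open>
  Functions are total, but maps that agree on \<^term>\<open>topspace X\<close> are homotopic, so values outside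
  the space do not affect a homotopy class. The composite of two classes is the class of the
  composite of any representatives (see \<open>Compose_HTop\<close> below).
\<close>

definition HTop :: "('a topology, ('a \<Rightarrow> 'a) set) cat" where
  "HTop = \<lparr>
     Obj = UNIV,
     Hom = (\<lambda>X Y. {f. continuous_map X Y f} // homotopy_rel X Y),
     Ident = (\<lambda>X. homotopy_class X X id),
     Compose = (\<lambda>X Y Z G F. \<Union>f\<in>F. \<Union>g\<in>G. homotopy_class X Z (g \<circ> f)) \<rparr>"


section \<open>Inverse systems and pro-categories\<close>

record ('i, 'o, 'm) inv_system =
  idx :: "'i set"
  le :: "'i \<Rightarrow> 'i \<Rightarrow> bool"
  space_at :: "'i \<Rightarrow> 'o"
  bond :: "'i \<Rightarrow> 'i \<Rightarrow> 'm"

text \<open>\<open>bond S i j\<close>, for \<open>i \<le> j\<close>, is the morphism from the object at \<open>j\<close> to the object at \<open>i\<close>.\<close>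

definition directed_set :: "'i set \<Rightarrow> ('i \<Rightarrow> 'i \<Rightarrow> bool) \<Rightarrow> bool" where
  "directed_set I r \<longleftrightarrow> I \<noteq> {} \<and>
     (\<forall>i\<in>I. r i i) \<and>
     (\<forall>i\<in>I. \<forall>j\<in>I. \<forall>k\<in>I. r i j \<longrightarrow> r j k \<longrightarrow> r i k) \<and>
     (\<forall>i\<in>I. \<forall>j\<in>I. \<exists>k\<in>I. r i k \<and> r j k)"

definition inverse_system :: "('o, 'm) cat \<Rightarrow> ('i, 'o, 'm) inv_system \<Rightarrow> bool" where
  "inverse_system C S \<longleftrightarrow> directed_set (idx S) (le S) \<and>
     (\<forall>i\<in>idx S. space_at S i \<in> Obj C) \<and>
     (\<forall>i\<in>idx S. \<forall>j\<in>idx S. le S i j \<longrightarrow> bond S i j \<in> Hom C (space_at S j) (space_at S i)) \<and>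
     (\<forall>i\<in>idx S. bond S i i = Ident C (space_at S i)) \<and>
     (\<forall>i\<in>idx S. \<forall>j\<in>idx S. \<forall>k\<in>idx S. le S i j \<longrightarrow> le S j k \<longrightarrow>
        Compose C (space_at S k) (space_at S j) (space_at S i) (bond S i j) (bond S j k)
          = bond S i k)"

text \<open>
  A morphism of systems \<open>X \<rightarrow> Y\<close> is a pair \<open>(f, \<phi>)\<close> with \<open>f m : X\<^bsub>\<phi> m\<^esub> \<rightarrow> Y\<^bsub>m\<^esub>\<close> for each index \<open>m\<close>
  of \<open>Y\<close>. \<open>pull C X Y (f, \<phi>) m l\<close> is the composite of \<open>f m\<close> with the bonding morphism
  \<open>X\<^bsub>l\<^esub> \<rightarrow> X\<^bsub>\<phi> m\<^esub>\<close>.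
\<close>

type_synonym ('i, 'j, 'm) sys_mor = "('j \<Rightarrow> 'm) \<times> ('j \<Rightarrow> 'i)"

definition pull :: "('o, 'm) cat \<Rightarrow> ('i, 'o, 'm) inv_system \<Rightarrow> ('j, 'o, 'm) inv_system
    \<Rightarrow> ('i, 'j, 'm) sys_mor \<Rightarrow> 'j \<Rightarrow> 'i \<Rightarrow> 'm" where
  "pull C X Y = (\<lambda>(f, \<phi>) m l.
     Compose C (space_at X l) (space_at X (\<phi> m)) (space_at Y m) (f m) (bond X (\<phi> m) l))"

definition sys_morphisms :: "('o, 'm) cat \<Rightarrow> ('i, 'o, 'm) inv_system \<Rightarrow> ('j, 'o, 'm) inv_system
    \<Rightarrow> ('i, 'j, 'm) sys_mor set" where
  "sys_morphisms C X Y = {(f, \<phi>).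
     (\<forall>m\<in>idx Y. \<phi> m \<in> idx X \<and> f m \<in> Hom C (space_at X (\<phi> m)) (space_at Y m)) \<and>
     (\<forall>m\<in>idx Y. \<forall>m'\<in>idx Y. le Y m m' \<longrightarrow>
        (\<exists>l\<in>idx X. le X (\<phi> m) l \<and> le X (\<phi> m') l \<and>
           pull C X Y (f, \<phi>) m l =
           Compose C (space_at X l) (space_at Y m') (space_at Y m)
             (bond Y m m') (pull C X Y (f, \<phi>) m' l)))}"

definition sys_equiv :: "('o, 'm) cat \<Rightarrow> ('i, 'o, 'm) inv_system \<Rightarrow> ('j, 'o, 'm) inv_system
    \<Rightarrow> (('i, 'j, 'm) sys_mor \<times> ('i, 'j, 'm) sys_mor) set" where
  "sys_equiv C X Y = {((f, \<phi>), (f', \<phi>')).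
     (f, \<phi>) \<in> sys_morphisms C X Y \<and> (f', \<phi>') \<in> sys_morphisms C X Y \<and>
     (\<forall>m\<in>idx Y. \<exists>l\<in>idx X. le X (\<phi> m) l \<and> le X (\<phi>' m) l \<and>
        pull C X Y (f, \<phi>) m l = pull C X Y (f', \<phi>') m l)}"

definition sys_ident :: "('o, 'm) cat \<Rightarrow> ('i, 'o, 'm) inv_system \<Rightarrow> ('i, 'i, 'm) sys_mor" where
  "sys_ident C X = ((\<lambda>i. Ident C (space_at X i)), id)"

definition sys_compose :: "('o, 'm) cat \<Rightarrow> ('i, 'o, 'm) inv_system \<Rightarrow> ('j, 'o, 'm) inv_system
    \<Rightarrow> ('k, 'o, 'm) inv_system \<Rightarrow> ('j, 'k, 'm) sys_mor \<Rightarrow> ('i, 'j, 'm) sys_mor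
    \<Rightarrow> ('i, 'k, 'm) sys_mor" where
  "sys_compose C X Y Z = (\<lambda>(g, \<psi>) (f, \<phi>).
     ((\<lambda>n. Compose C (space_at X (\<phi> (\<psi> n))) (space_at Y (\<psi> n)) (space_at Z n) (g n) (f (\<psi> n))),
      \<phi> \<circ> \<psi>))"

text \<open>The index sets of the systems are subsets of a fixed type \<open>'i\<close>.\<close>

definition Pro :: "('o, 'm) cat \<Rightarrow> (('i, 'o, 'm) inv_system, ('i, 'i, 'm) sys_mor set) cat" where
  "Pro C = \<lparr>
     Obj = {S. inverse_system C S},
     Hom = (\<lambda>X Y. sys_morphisms C X Y // sys_equiv C X Y),
     Ident = (\<lambda>X. sys_equiv C X X `` {sys_ident C X}),
     Compose = (\<lambda>X Y Z G F. \<Union>f\<in>F. \<Union>g\<in>G. sys_equiv C X Z `` {sys_compose C X Y Z g f}) \<rparr>"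


section \<open>Inverse sequences of spaces\<close>

text \<open>
  \<open>iterated_bond q m k\<close> is the composite \<open>q m \<circ> q (m + 1) \<circ> \<dots> \<circ> q (m + k - 1)\<close>, where
  \<open>q n\<close> maps the \<open>(n + 1)\<close>-st space to the \<open>n\<close>-th.
\<close>

primrec iterated_bond :: "(nat \<Rightarrow> 'a \<Rightarrow> 'a) \<Rightarrow> nat \<Rightarrow> nat \<Rightarrow> 'a \<Rightarrow> 'a" where
  "iterated_bond q m 0 = id"
| "iterated_bond q m (Suc k) = iterated_bond q m k \<circ> q (m + k)"

definition htop_sequence ::
    "(nat \<Rightarrow> 'a topology) \<Rightarrow> (nat \<Rightarrow> 'a \<Rightarrow> 'a) \<Rightarrow> (nat, 'a topology, ('a \<Rightarrow> 'a) set) inv_system" where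
  "htop_sequence T q = \<lparr>
     idx = {1..},
     le = (\<le>),
     space_at = T,
     bond = (\<lambda>m n. homotopy_class (T n) (T m) (iterated_bond q m (n - m))) \<rparr>"


section \<open>Finite approximative sequences with opposite order\<close>

definition approximation :: "'a::metric_space set \<Rightarrow> real \<Rightarrow> 'a set \<Rightarrow> bool" where
  "approximation X \<epsilon> A \<longleftrightarrow> \<epsilon> > 0 \<and> finite A \<and> A \<subseteq> X \<and> (\<forall>x\<in>X. \<exists>a\<in>A. dist x a < \<epsilon>)"

text \<open>\<open>U_set r A\<close> is the set written \<open>\<U>\<^bsub>r\<^esub>(A)\<close> in the literature.\<close>

definition U_set :: "real \<Rightarrow> 'a::metric_space set \<Rightarrow> 'a set set" where
  "U_set r A = {C. C \<noteq> {} \<and> C \<subseteq> A \<and> diameter C < r}"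

definition U_le :: "'a set \<Rightarrow> 'a set \<Rightarrow> bool" where
  "U_le C D \<longleftrightarrow> D \<subseteq> C"

definition U_lower :: "real \<Rightarrow> 'a::metric_space set \<Rightarrow> 'a set set \<Rightarrow> bool" where
  "U_lower r A S \<longleftrightarrow> S \<subseteq> U_set r A \<and> (\<forall>D\<in>S. \<forall>C\<in>U_set r A. U_le C D \<longrightarrow> C \<in> S)"

definition U_space :: "real \<Rightarrow> 'a::metric_space set \<Rightarrow> 'a set topology" where
  "U_space r A = topology (U_lower r A)"

definition covering_radius :: "'a::metric_space set \<Rightarrow> 'a set \<Rightarrow> real" where
  "covering_radius X A = (SUP x\<in>X. infdist x A)"

definition q_map :: "real \<Rightarrow> 'a::metric_space set \<Rightarrow> 'a set \<Rightarrow> 'a set" where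
  "q_map \<epsilon> A C = (\<Union>x\<in>C. ball x \<epsilon> \<inter> A)"

text \<open>
  A sequence of this kind is determined by the numbers \<open>\<epsilon> n\<close> and the sets \<open>A n\<close>, \<open>n \<ge> 1\<close>;
  the values at \<open>0\<close> are irrelevant.
\<close>

definition FASO :: "'a::metric_space set \<Rightarrow> (nat \<Rightarrow> real) \<Rightarrow> (nat \<Rightarrow> 'a set) \<Rightarrow> bool" where
  "FASO X \<epsilon> A \<longleftrightarrow>
     \<epsilon> 1 > diameter X \<and>
     (\<forall>n\<ge>1. approximation X (\<epsilon> n) (A n)) \<and>
     (\<forall>n\<ge>1. 0 < \<epsilon> (Suc n) \<and> \<epsilon> (Suc n) < (\<epsilon> n - covering_radius X (A n)) / 2)"

definition FASO_system :: "(nat \<Rightarrow> real) \<Rightarrow> (nat \<Rightarrow> 'a::metric_space set)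
    \<Rightarrow> (nat, 'a set topology, ('a set \<Rightarrow> 'a set) set) inv_system" where
  "FASO_system \<epsilon> A =
     htop_sequence (\<lambda>n. U_space (4 * \<epsilon> n) (A n)) (\<lambda>n. q_map (\<epsilon> n) (A n))"


section \<open>The constructions are well defined\<close>

lemma openin_U_space: "openin (U_space r A) S \<longleftrightarrow> U_lower r A S"
proof -
  have "istopology (U_lower r A)"
    unfolding istopology_def U_lower_def by blast
  then show ?thesis
    by (simp add: U_space_def topology_inverse')
qed

lemma topspace_U_space: "topspace (U_space r A) = U_set r A"
  unfolding topspace_def openin_U_space by (auto simp: U_lower_def)

lemma equiv_homotopy_rel: "equiv {f. continuous_map X Y f} (homotopy_rel X Y)"
  unfolding equiv_def refl_on_def sym_def trans_def homotopy_rel_def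
  by (auto dest: homotopic_with_imp_continuous_maps homotopic_with_symD
      intro: homotopic_with_trans)

lemma homotopy_class_eq_iff:
  assumes "continuous_map X Y f" "continuous_map X Y g"
  shows "homotopy_class X Y f = homotopy_class X Y g \<longleftrightarrow> homotopic_with (\<lambda>_. True) X Y f g"
  using eq_equiv_class_iff[OF equiv_homotopy_rel, of f X Y g] assms
  by (auto simp: homotopy_class_def homotopy_rel_def)

lemma Hom_HTop: "Hom HTop X Y = {homotopy_class X Y f | f. continuous_map X Y f}"
  by (auto simp: HTop_def homotopy_class_def quotient_def)

lemma Compose_HTop:
  assumes f: "continuous_map X Y f" and g: "continuous_map Y Z g"
  shows "Compose HTop X Y Z (homotopy_class Y Z g) (homotopy_class X Y f)
    = homotopy_class X Z (g \<circ> f)"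
proof -
  have "homotopy_class X Z (g' \<circ> f') = homotopy_class X Z (g \<circ> f)"
    if "f' \<in> homotopy_class X Y f" "g' \<in> homotopy_class Y Z g" for f' g'
  proof -
    have h: "homotopic_with (\<lambda>_. True) X Y f f'" "homotopic_with (\<lambda>_. True) Y Z g g'"
      using that by (auto simp: homotopy_class_def homotopy_rel_def)
    note c = homotopic_with_imp_continuous_maps[OF h(1)] homotopic_with_imp_continuous_maps[OF h(2)]
    have "homotopic_with (\<lambda>_. True) X Z (g \<circ> f) (g \<circ> f')"
      using homotopic_with_compose_continuous_map_left[OF h(1) g] by simp
    moreover have "homotopic_with (\<lambda>_. True) X Z (g \<circ> f') (g' \<circ> f')"
      using homotopic_with_compose_continuous_map_right[OF h(2), of X f' "\<lambda>_. True"] c by simp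
    ultimately have "homotopic_with (\<lambda>_. True) X Z (g \<circ> f) (g' \<circ> f')"
      by (rule homotopic_with_trans)
    moreover have "continuous_map X Z (g \<circ> f)" "continuous_map X Z (g' \<circ> f')"
      using c f g continuous_map_compose by blast+
    ultimately show ?thesis
      by (simp add: homotopy_class_eq_iff homotopic_with_symD)
  qed
  then have "(\<Union>f'\<in>homotopy_class X Y f. \<Union>g'\<in>homotopy_class Y Z g. homotopy_class X Z (g' \<circ> f')) =
    (\<Union>f'\<in>homotopy_class X Y f. \<Union>g'\<in>homotopy_class Y Z g. homotopy_class X Z (g \<circ> f))"
    by (intro SUP_cong refl)
  moreover have "f \<in> homotopy_class X Y f" "g \<in> homotopy_class Y Z g"
    using f g by (auto simp: homotopy_class_def homotopy_rel_def)
  then have "homotopy_class X Y f \<noteq> {}" "homotopy_class Y Z g \<noteq> {}"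
    by auto
  ultimately show ?thesis
    by (simp add: HTop_def)
qed

theorem category_HTop: "category HTop"
proof
  fix X Y Z W :: "'a topology" and f g h
  show "Ident HTop X \<in> Hom HTop X X"
    unfolding Hom_HTop by (auto simp: HTop_def intro!: exI[of _ id])
  show "Compose HTop X Y Z g f \<in> Hom HTop X Z" if "f \<in> Hom HTop X Y" "g \<in> Hom HTop Y Z"
    using that unfolding Hom_HTop by (auto simp: Compose_HTop continuous_map_compose)
  have id: "Ident HTop X = homotopy_class X X id" for X :: "'a topology"
    by (simp add: HTop_def)
  show "Compose HTop X Y Y (Ident HTop Y) f = f" if "f \<in> Hom HTop X Y"
    using that unfolding Hom_HTop by (auto simp: Compose_HTop id)
  show "Compose HTop X X Y f (Ident HTop X) = f" if "f \<in> Hom HTop X Y"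
    using that unfolding Hom_HTop by (auto simp: Compose_HTop id)
  show "Compose HTop W X Z (Compose HTop X Y Z h g) f = Compose HTop W Y Z h (Compose HTop W X Y g f)"
    if "f \<in> Hom HTop W X" "g \<in> Hom HTop X Y" "h \<in> Hom HTop Y Z"
    using that unfolding Hom_HTop
    by (auto simp: Compose_HTop continuous_map_compose o_assoc)
qed

context category
begin

lemma sys_le_refl: "inverse_system C X \<Longrightarrow> i \<in> idx X \<Longrightarrow> le X i i"
  by (simp add: inverse_system_def directed_set_def)

lemma sys_upper: "inverse_system C X \<Longrightarrow> i \<in> idx X \<Longrightarrow> j \<in> idx X \<Longrightarrow>
    \<exists>k\<in>idx X. le X i k \<and> le X j k"
  unfolding inverse_system_def directed_set_def by blast

lemma sys_leI:
  assumes "inverse_system C X" "le X i j" "le X j k" "i \<in> idx X" "j \<in> idx X" "k \<in> idx X"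
  shows "le X i k"
  using assms(2-5) assms(1)[unfolded inverse_system_def directed_set_def] assms(6) by blast

lemma obj_at: "inverse_system C X \<Longrightarrow> i \<in> idx X \<Longrightarrow> space_at X i \<in> Obj C"
  by (simp add: inverse_system_def)

lemma bond_Hom: "\<lbrakk>inverse_system C X; i \<in> idx X; j \<in> idx X; le X i j\<rbrakk>
    \<Longrightarrow> bond X i j \<in> Hom C (space_at X j) (space_at X i)"
  by (simp add: inverse_system_def)

lemma bond_bond: "\<lbrakk>inverse_system C X; i \<in> idx X; j \<in> idx X; k \<in> idx X; le X i j; le X j k\<rbrakk>
    \<Longrightarrow> Compose C (space_at X k) (space_at X j) (space_at X i) (bond X i j) (bond X j k) = bond X i k"
  by (simp add: inverse_system_def)

lemma pull_Hom:
  assumes "inverse_system C X" "inverse_system C Y" "(f, \<phi>) \<in> sys_morphisms C X Y"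
    "m \<in> idx Y" "l \<in> idx X" "le X (\<phi> m) l"
  shows "pull C X Y (f, \<phi>) m l \<in> Hom C (space_at X l) (space_at Y m)"
  using assms by (auto simp: pull_def sys_morphisms_def inverse_system_def intro!: comp)

lemma pull_bond:
  assumes X: "inverse_system C X" and Y: "inverse_system C Y"
    and F: "(f, \<phi>) \<in> sys_morphisms C X Y"
    and m: "m \<in> idx Y" "l \<in> idx X" "l' \<in> idx X" "le X (\<phi> m) l" "le X l l'"
  shows "Compose C (space_at X l') (space_at X l) (space_at Y m) (pull C X Y (f, \<phi>) m l) (bond X l l')
    = pull C X Y (f, \<phi>) m l'"
proof -
  have \<phi>: "\<phi> m \<in> idx X" "f m \<in> Hom C (space_at X (\<phi> m)) (space_at Y m)"
    using F m by (auto simp: sys_morphisms_def)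
  have b: "bond X (\<phi> m) l \<in> Hom C (space_at X l) (space_at X (\<phi> m))"
    "bond X l l' \<in> Hom C (space_at X l') (space_at X l)"
    "space_at X l \<in> Obj C" "space_at X l' \<in> Obj C" "space_at X (\<phi> m) \<in> Obj C"
    "space_at Y m \<in> Obj C"
    "Compose C (space_at X l') (space_at X l) (space_at X (\<phi> m)) (bond X (\<phi> m) l) (bond X l l')
      = bond X (\<phi> m) l'"
    by (intro obj_at bond_Hom bond_bond X Y m \<phi>)+
  show ?thesis
    by (simp add: pull_def assoc[OF b(4,3,5,6) b(2,1) \<phi>(2)] b(7))
qed

lemma pull_eq_mono:
  assumes "inverse_system C X" "inverse_system C Y"
    "(f, \<phi>) \<in> sys_morphisms C X Y" "(f', \<phi>') \<in> sys_morphisms C X Y"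
    "m \<in> idx Y" "l \<in> idx X" "l' \<in> idx X" "le X (\<phi> m) l" "le X (\<phi>' m) l" "le X l l'"
    "pull C X Y (f, \<phi>) m l = pull C X Y (f', \<phi>') m l"
  shows "pull C X Y (f, \<phi>) m l' = pull C X Y (f', \<phi>') m l'"
  using pull_bond[OF assms(1-3,5-8,10)] pull_bond[OF assms(1,2,4,5-7,9,10)] assms(11) by metis

lemma sys_morphisms_eventually:
  assumes X: "inverse_system C X" and Y: "inverse_system C Y"
    and F: "(f, \<phi>) \<in> sys_morphisms C X Y"
    and m: "m \<in> idx Y" "m' \<in> idx Y" "le Y m m'"
  obtains l0 where "l0 \<in> idx X" "le X (\<phi> m) l0" "le X (\<phi> m') l0"
    "\<And>l. l \<in> idx X \<Longrightarrow> le X l0 l \<Longrightarrow> pull C X Y (f, \<phi>) m l =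
           Compose C (space_at X l) (space_at Y m') (space_at Y m)
             (bond Y m m') (pull C X Y (f, \<phi>) m' l)"
proof -
  obtain l0 where l0: "l0\<in>idx X" "le X (\<phi> m) l0" "le X (\<phi> m') l0"
    "pull C X Y (f, \<phi>) m l0 = Compose C (space_at X l0) (space_at Y m') (space_at Y m)
             (bond Y m m') (pull C X Y (f, \<phi>) m' l0)"
    using F m unfolding sys_morphisms_def by blast
  have "pull C X Y (f, \<phi>) m l = Compose C (space_at X l) (space_at Y m') (space_at Y m)
             (bond Y m m') (pull C X Y (f, \<phi>) m' l)" if l: "l \<in> idx X" "le X l0 l" for l
  proof -
    have *: "space_at X l \<in> Obj C" "space_at X l0 \<in> Obj C" "space_at Y m \<in> Obj C"
      "space_at Y m' \<in> Obj C" "bond X l0 l \<in> Hom C (space_at X l) (space_at X l0)"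
      "bond Y m m' \<in> Hom C (space_at Y m') (space_at Y m)"
      by (intro obj_at bond_Hom X Y l0 l m)+
    show ?thesis
      using pull_bond[OF X Y F m(1) l0(1) l(1) l0(2) l(2)]
        pull_bond[OF X Y F m(2) l0(1) l(1) l0(3) l(2)] l0(4)
        assoc[OF *(1,2,4,3) *(5) pull_Hom[OF X Y F m(2) l0(1,3)] *(6)] by simp
  qed
  with l0 that show thesis by blast
qed

lemma equiv_sys_equiv:
  assumes X: "inverse_system C X" and Y: "inverse_system C Y"
  shows "equiv (sys_morphisms C X Y) (sys_equiv C X Y)"
  unfolding equiv_def
proof (intro conjI)
  show "sys_equiv C X Y \<subseteq> sys_morphisms C X Y \<times> sys_morphisms C X Y"
    by (auto simp: sys_equiv_def)
  show "refl_on (sys_morphisms C X Y) (sys_equiv C X Y)"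
  proof (rule refl_onI)
    fix F assume F: "F \<in> sys_morphisms C X Y"
    obtain f \<phi> where eq: "F = (f, \<phi>)" by (cases F)
    have "\<phi> m \<in> idx X" "le X (\<phi> m) (\<phi> m)" if "m \<in> idx Y" for m
      using F that sys_le_refl[OF X, of "\<phi> m"] by (auto simp: eq sys_morphisms_def)
    then show "(F, F) \<in> sys_equiv C X Y"
      using F unfolding eq sys_equiv_def by blast
  qed
  show "sym (sys_equiv C X Y)"
    unfolding sym_def sys_equiv_def by clarsimp metis
  show "trans (sys_equiv C X Y)"
    unfolding trans_def
  proof (clarify)
    fix f \<phi> f' \<phi>' f'' \<phi>''
    assume a: "((f, \<phi>), (f', \<phi>')) \<in> sys_equiv C X Y" "((f', \<phi>'), (f'', \<phi>'')) \<in> sys_equiv C X Y"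
    then have M: "(f, \<phi>) \<in> sys_morphisms C X Y" "(f', \<phi>') \<in> sys_morphisms C X Y"
      "(f'', \<phi>'') \<in> sys_morphisms C X Y"
      by (auto simp: sys_equiv_def)
    have "\<exists>l\<in>idx X. le X (\<phi> m) l \<and> le X (\<phi>'' m) l \<and>
        pull C X Y (f, \<phi>) m l = pull C X Y (f'', \<phi>'') m l" if m: "m \<in> idx Y" for m
    proof -
      obtain l1 where l1: "l1 \<in> idx X" "le X (\<phi> m) l1" "le X (\<phi>' m) l1"
        "pull C X Y (f, \<phi>) m l1 = pull C X Y (f', \<phi>') m l1"
        using a(1) m unfolding sys_equiv_def by blast
      obtain l2 where l2: "l2 \<in> idx X" "le X (\<phi>' m) l2" "le X (\<phi>'' m) l2"
        "pull C X Y (f', \<phi>') m l2 = pull C X Y (f'', \<phi>'') m l2"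
        using a(2) m unfolding sys_equiv_def by blast
      obtain l where l: "l \<in> idx X" "le X l1 l" "le X l2 l"
        using sys_upper[OF X l1(1) l2(1)] by blast
      have "\<phi> m \<in> idx X" "\<phi>'' m \<in> idx X"
        using M m by (auto simp: sys_morphisms_def)
      then have "le X (\<phi> m) l" "le X (\<phi>'' m) l"
        using sys_leI[OF X l1(2) l(2)] sys_leI[OF X l2(3) l(3)] l(1) l1(1) l2(1) by blast+
      moreover have "pull C X Y (f, \<phi>) m l = pull C X Y (f'', \<phi>'') m l"
        using pull_eq_mono[OF X Y M(1,2) m l1(1) l(1) l1(2,3) l(2) l1(4)]
          pull_eq_mono[OF X Y M(2,3) m l2(1) l(1) l2(2,3) l(3) l2(4)] by simp
      ultimately show ?thesis using l(1) by blast
    qed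
    then show "((f, \<phi>), (f'', \<phi>'')) \<in> sys_equiv C X Y"
      using M by (simp add: sys_equiv_def)
  qed
qed

lemma sys_equivI:
  assumes X: "inverse_system C X"
    and F: "(f, \<phi>) \<in> sys_morphisms C X Y" "(f', \<phi>') \<in> sys_morphisms C X Y"
    and eq: "\<And>m. m \<in> idx Y \<Longrightarrow> f m = f' m" "\<And>m. m \<in> idx Y \<Longrightarrow> \<phi> m = \<phi>' m"
  shows "((f, \<phi>), (f', \<phi>')) \<in> sys_equiv C X Y"
proof -
  have "le X (\<phi> m) (\<phi> m)" "\<phi> m \<in> idx X" if "m \<in> idx Y" for m
    using X F that by (auto simp: inverse_system_def directed_set_def sys_morphisms_def)
  then show ?thesis
    using F eq by (auto simp: sys_equiv_def pull_def intro!: bexI)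
qed

lemma pull_sys_compose:
  assumes X: "inverse_system C X" and Y: "inverse_system C Y" and Z: "inverse_system C Z"
    and F: "(f, \<phi>) \<in> sys_morphisms C X Y" and G: "(g, \<psi>) \<in> sys_morphisms C Y Z"
    and n: "n \<in> idx Z" and m: "m \<in> idx Y" "le Y (\<psi> n) m"
  obtains l0 where "l0 \<in> idx X" "le X (\<phi> (\<psi> n)) l0" "le X (\<phi> m) l0"
    "\<And>l. l \<in> idx X \<Longrightarrow> le X l0 l \<Longrightarrow> pull C X Z (sys_compose C X Y Z (g, \<psi>) (f, \<phi>)) n l =
       Compose C (space_at X l) (space_at Y m) (space_at Z n)
         (pull C Y Z (g, \<psi>) n m) (pull C X Y (f, \<phi>) m l)"
proof -
  have \<psi>: "\<psi> n \<in> idx Y" "g n \<in> Hom C (space_at Y (\<psi> n)) (space_at Z n)"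
    using G n by (auto simp: sys_morphisms_def)
  have \<phi>: "\<phi> (\<psi> n) \<in> idx X" "f (\<psi> n) \<in> Hom C (space_at X (\<phi> (\<psi> n))) (space_at Y (\<psi> n))"
    "\<phi> m \<in> idx X"
    using F \<psi> m by (auto simp: sys_morphisms_def)
  obtain l0 where l0: "l0 \<in> idx X" "le X (\<phi> (\<psi> n)) l0" "le X (\<phi> m) l0"
    "\<And>l. l \<in> idx X \<Longrightarrow> le X l0 l \<Longrightarrow> pull C X Y (f, \<phi>) (\<psi> n) l =
           Compose C (space_at X l) (space_at Y m) (space_at Y (\<psi> n))
             (bond Y (\<psi> n) m) (pull C X Y (f, \<phi>) m l)"
    using sys_morphisms_eventually[OF X Y F \<psi>(1) m] by blast
  have "pull C X Z (sys_compose C X Y Z (g, \<psi>) (f, \<phi>)) n l =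
       Compose C (space_at X l) (space_at Y m) (space_at Z n)
         (pull C Y Z (g, \<psi>) n m) (pull C X Y (f, \<phi>) m l)" if l: "l \<in> idx X" "le X l0 l" for l
  proof -
    have le: "le X (\<phi> (\<psi> n)) l" "le X (\<phi> m) l"
      using sys_leI[OF X l0(2) l(2)] sys_leI[OF X l0(3) l(2)] l(1) l0(1) \<phi> by blast+
    have *: "space_at X l \<in> Obj C" "space_at X (\<phi> (\<psi> n)) \<in> Obj C" "space_at Y (\<psi> n) \<in> Obj C"
      "space_at Y m \<in> Obj C" "space_at Z n \<in> Obj C"
      "bond X (\<phi> (\<psi> n)) l \<in> Hom C (space_at X l) (space_at X (\<phi> (\<psi> n)))"
      "bond Y (\<psi> n) m \<in> Hom C (space_at Y m) (space_at Y (\<psi> n))"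
      by (intro obj_at bond_Hom X Y Z l m n le \<phi> \<psi>)+
    have "pull C X Z (sys_compose C X Y Z (g, \<psi>) (f, \<phi>)) n l =
      Compose C (space_at X l) (space_at Y (\<psi> n)) (space_at Z n) (g n) (pull C X Y (f, \<phi>) (\<psi> n) l)"
      using assoc[OF *(1,2,3,5,6) \<phi>(2) \<psi>(2)] by (simp add: pull_def sys_compose_def)
    also have "\<dots> = Compose C (space_at X l) (space_at Y m) (space_at Z n)
         (pull C Y Z (g, \<psi>) n m) (pull C X Y (f, \<phi>) m l)"
      using assoc[OF *(1,4,3,5) pull_Hom[OF X Y F m(1) l(1) le(2)] *(7) \<psi>(2)] l0(4)[OF l]
      by (simp add: pull_def)
    finally show ?thesis .
  qed
  with l0 that show thesis by blast
qed

lemma sys_compose_in: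
  assumes X: "inverse_system C X" and Y: "inverse_system C Y" and Z: "inverse_system C Z"
    and F: "(f, \<phi>) \<in> sys_morphisms C X Y" and G: "(g, \<psi>) \<in> sys_morphisms C Y Z"
  shows "sys_compose C X Y Z (g, \<psi>) (f, \<phi>) \<in> sys_morphisms C X Z"
proof -
  let ?GF = "sys_compose C X Y Z (g, \<psi>) (f, \<phi>)"
  have 1: "\<phi> (\<psi> n) \<in> idx X"
      "Compose C (space_at X (\<phi> (\<psi> n))) (space_at Y (\<psi> n)) (space_at Z n) (g n) (f (\<psi> n))
        \<in> Hom C (space_at X (\<phi> (\<psi> n))) (space_at Z n)" if "n \<in> idx Z" for n
    using F G X Y Z that by (auto simp: sys_morphisms_def inverse_system_def intro!: comp)
  have 2: "\<exists>l\<in>idx X. le X (\<phi> (\<psi> n)) l \<and> le X (\<phi> (\<psi> n')) l \<and>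
           pull C X Z ?GF n l =
           Compose C (space_at X l) (space_at Z n') (space_at Z n) (bond Z n n') (pull C X Z ?GF n' l)"
    if n: "n \<in> idx Z" "n' \<in> idx Z" "le Z n n'" for n n'
  proof -
    obtain m where m: "m \<in> idx Y" "le Y (\<psi> n) m" "le Y (\<psi> n') m"
      "pull C Y Z (g, \<psi>) n m = Compose C (space_at Y m) (space_at Z n') (space_at Z n)
        (bond Z n n') (pull C Y Z (g, \<psi>) n' m)"
      using G n unfolding sys_morphisms_def by blast
    obtain l1 where l1: "l1 \<in> idx X" "le X (\<phi> (\<psi> n)) l1" "le X (\<phi> m) l1"
      "\<And>l. l \<in> idx X \<Longrightarrow> le X l1 l \<Longrightarrow> pull C X Z ?GF n l =
       Compose C (space_at X l) (space_at Y m) (space_at Z n)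
         (pull C Y Z (g, \<psi>) n m) (pull C X Y (f, \<phi>) m l)"
      by (rule pull_sys_compose[OF X Y Z F G n(1) m(1,2)]) (rule that)
    obtain l2 where l2: "l2 \<in> idx X" "le X (\<phi> (\<psi> n')) l2" "le X (\<phi> m) l2"
      "\<And>l. l \<in> idx X \<Longrightarrow> le X l2 l \<Longrightarrow> pull C X Z ?GF n' l =
       Compose C (space_at X l) (space_at Y m) (space_at Z n')
         (pull C Y Z (g, \<psi>) n' m) (pull C X Y (f, \<phi>) m l)"
      by (rule pull_sys_compose[OF X Y Z F G n(2) m(1,3)]) (rule that)
    obtain l where l: "l \<in> idx X" "le X l1 l" "le X l2 l"
      using sys_upper[OF X l1(1) l2(1)] by blast
    have "\<phi> m \<in> idx X" using F m by (auto simp: sys_morphisms_def)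
    then have le: "le X (\<phi> (\<psi> n)) l" "le X (\<phi> (\<psi> n')) l" "le X (\<phi> m) l"
      using sys_leI[OF X l1(2) l(2)] sys_leI[OF X l2(2) l(3)] sys_leI[OF X l1(3) l(2)]
        l(1) l1(1) l2(1) 1(1) n by blast+
    have *: "space_at X l \<in> Obj C" "space_at Y m \<in> Obj C" "space_at Z n \<in> Obj C"
      "space_at Z n' \<in> Obj C" "bond Z n n' \<in> Hom C (space_at Z n') (space_at Z n)"
      by (intro obj_at bond_Hom X Y Z n m l)+
    show ?thesis
      using le l(1) assoc[OF *(1,2,4,3) pull_Hom[OF X Y F m(1) l(1) le(3)] pull_Hom[OF Y Z G n(2) m(1,3)] *(5)]
        l1(4)[OF l(1,2)] l2(4)[OF l(1,3)] m(4) by auto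
  qed
  show ?thesis
    using 1 2 unfolding sys_morphisms_def sys_compose_def by simp
qed

lemma sys_compose_cong:
  assumes X: "inverse_system C X" and Y: "inverse_system C Y" and Z: "inverse_system C Z"
    and F: "((f, \<phi>), (f', \<phi>')) \<in> sys_equiv C X Y" and G: "((g, \<psi>), (g', \<psi>')) \<in> sys_equiv C Y Z"
  shows "(sys_compose C X Y Z (g, \<psi>) (f, \<phi>), sys_compose C X Y Z (g', \<psi>') (f', \<phi>')) \<in> sys_equiv C X Z"
    (is "(?GF, ?GF') \<in> _")
proof -
  have M: "(f, \<phi>) \<in> sys_morphisms C X Y" "(f', \<phi>') \<in> sys_morphisms C X Y"
    "(g, \<psi>) \<in> sys_morphisms C Y Z" "(g', \<psi>') \<in> sys_morphisms C Y Z"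
    using F G by (auto simp: sys_equiv_def)
  have "\<exists>l\<in>idx X. le X (\<phi> (\<psi> n)) l \<and> le X (\<phi>' (\<psi>' n)) l \<and> pull C X Z ?GF n l = pull C X Z ?GF' n l"
    if n: "n \<in> idx Z" for n
  proof -
    obtain m where m: "m \<in> idx Y" "le Y (\<psi> n) m" "le Y (\<psi>' n) m"
      "pull C Y Z (g, \<psi>) n m = pull C Y Z (g', \<psi>') n m"
      using G n unfolding sys_equiv_def by blast
    obtain l1 where l1: "l1 \<in> idx X" "le X (\<phi> (\<psi> n)) l1" "le X (\<phi> m) l1"
      "\<And>l. l \<in> idx X \<Longrightarrow> le X l1 l \<Longrightarrow> pull C X Z ?GF n l =
       Compose C (space_at X l) (space_at Y m) (space_at Z n)
         (pull C Y Z (g, \<psi>) n m) (pull C X Y (f, \<phi>) m l)"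
      by (rule pull_sys_compose[OF X Y Z M(1,3) n m(1,2)]) (rule that)
    obtain l2 where l2: "l2 \<in> idx X" "le X (\<phi>' (\<psi>' n)) l2" "le X (\<phi>' m) l2"
      "\<And>l. l \<in> idx X \<Longrightarrow> le X l2 l \<Longrightarrow> pull C X Z ?GF' n l =
       Compose C (space_at X l) (space_at Y m) (space_at Z n)
         (pull C Y Z (g', \<psi>') n m) (pull C X Y (f', \<phi>') m l)"
      by (rule pull_sys_compose[OF X Y Z M(2,4) n m(1,3)]) (rule that)
    obtain l3 where l3: "l3 \<in> idx X" "le X (\<phi> m) l3" "le X (\<phi>' m) l3"
      "pull C X Y (f, \<phi>) m l3 = pull C X Y (f', \<phi>') m l3"
      using F m(1) unfolding sys_equiv_def by blast
    obtain l4 where l4: "l4 \<in> idx X" "le X l1 l4" "le X l2 l4"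
      using sys_upper[OF X l1(1) l2(1)] by blast
    obtain l where l: "l \<in> idx X" "le X l4 l" "le X l3 l"
      using sys_upper[OF X l4(1) l3(1)] by blast
    have l: "l \<in> idx X" "le X l1 l" "le X l2 l" "le X l3 l"
      using l sys_leI[OF X l4(2) l(2)] sys_leI[OF X l4(3) l(2)] l1(1) l2(1) l4(1) by auto
    have "\<phi> (\<psi> n) \<in> idx X" "\<phi>' (\<psi>' n) \<in> idx X"
      using M n by (auto simp: sys_morphisms_def)
    then have "le X (\<phi> (\<psi> n)) l" "le X (\<phi>' (\<psi>' n)) l"
      using sys_leI[OF X l1(2) l(2)] sys_leI[OF X l2(2) l(3)] l(1) l1(1) l2(1) by blast+
    moreover have "pull C X Y (f, \<phi>) m l = pull C X Y (f', \<phi>') m l"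
      using pull_eq_mono[OF X Y M(1,2) m(1) l3(1) l(1) l3(2,3) l(4) l3(4)] .
    ultimately show ?thesis
      using l(1) l1(4)[OF l(1,2)] l2(4)[OF l(1,3)] m(4) by auto
  qed
  then show ?thesis
    using sys_compose_in[OF X Y Z M(1,3)] sys_compose_in[OF X Y Z M(2,4)]
    unfolding sys_equiv_def by (auto simp: sys_compose_def)
qed

lemma sys_ident_in:
  assumes X: "inverse_system C X"
  shows "sys_ident C X \<in> sys_morphisms C X X"
proof -
  have *: "pull C X X (sys_ident C X) m l = bond X m l"
    if "m \<in> idx X" "l \<in> idx X" "le X m l" for m l
    using X that by (auto simp: pull_def sys_ident_def inverse_system_def intro!: ident_left)
  have "\<exists>l\<in>idx X. le X m l \<and> le X m' l \<and> pull C X X (sys_ident C X) m l =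
      Compose C (space_at X l) (space_at X m') (space_at X m) (bond X m m')
        (pull C X X (sys_ident C X) m' l)"
    if "m \<in> idx X" "m' \<in> idx X" "le X m m'" for m m'
  proof (rule bexI[of _ m'])
    have "le X m' m'" using sys_le_refl[OF X that(2)] .
    moreover from this have "Compose C (space_at X m') (space_at X m') (space_at X m)
        (bond X m m') (bond X m' m') = bond X m m'"
      using bond_bond[OF X that(1,2,2,3)] by blast
    ultimately show "le X m m' \<and> le X m' m' \<and> pull C X X (sys_ident C X) m m' =
      Compose C (space_at X m') (space_at X m') (space_at X m) (bond X m m')
        (pull C X X (sys_ident C X) m' m')"
      using that * by auto
  qed (use that in auto)
  moreover have "Ident C (space_at X m) \<in> Hom C (space_at X m) (space_at X m)" if "m \<in> idx X" for m
    using X that by (auto simp: inverse_system_def intro: ident)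
  ultimately show ?thesis
    by (auto simp: sys_morphisms_def sys_ident_def)
qed

lemma Hom_Pro: "Hom (Pro C) X Y = {sys_equiv C X Y `` {F} | F. F \<in> sys_morphisms C X Y}"
  by (auto simp: Pro_def quotient_def)

lemma sys_class_eqI:
  assumes "inverse_system C X" "inverse_system C Y" "(F, G) \<in> sys_equiv C X Y"
  shows "sys_equiv C X Y `` {F} = sys_equiv C X Y `` {G}"
  using equiv_class_eq[OF equiv_sys_equiv] assms by blast

lemma Compose_Pro:
  assumes X: "inverse_system C X" and Y: "inverse_system C Y" and Z: "inverse_system C Z"
    and F: "F \<in> sys_morphisms C X Y" and G: "G \<in> sys_morphisms C Y Z"
  shows "Compose (Pro C) X Y Z (sys_equiv C Y Z `` {G}) (sys_equiv C X Y `` {F})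
    = sys_equiv C X Z `` {sys_compose C X Y Z G F}"
proof -
  have eq: "sys_equiv C X Z `` {sys_compose C X Y Z G' F'} = sys_equiv C X Z `` {sys_compose C X Y Z G F}"
    if "(F, F') \<in> sys_equiv C X Y" "(G, G') \<in> sys_equiv C Y Z" for F' G'
    using that sys_class_eqI[OF X Z] sys_compose_cong[OF X Y Z]
    by (cases F; cases F'; cases G; cases G') blast
  have "(F, F) \<in> sys_equiv C X Y" "(G, G) \<in> sys_equiv C Y Z"
    using equiv_sys_equiv[OF X Y] equiv_sys_equiv[OF Y Z] F G
    by (auto simp: equiv_def refl_on_def)
  then have ne: "sys_equiv C X Y `` {F} \<noteq> {}" "sys_equiv C Y Z `` {G} \<noteq> {}"
    by auto
  have "(\<Union>F'\<in>sys_equiv C X Y `` {F}. \<Union>G'\<in>sys_equiv C Y Z `` {G}.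
      sys_equiv C X Z `` {sys_compose C X Y Z G' F'}) =
    (\<Union>F'\<in>sys_equiv C X Y `` {F}. \<Union>G'\<in>sys_equiv C Y Z `` {G}.
      sys_equiv C X Z `` {sys_compose C X Y Z G F})"
    by (intro SUP_cong refl eq) auto
  then show ?thesis
    using ne by (simp add: Pro_def)
qed

theorem category_Pro: "category (Pro C :: (('i, 'o, 'm) inv_system, _) cat)"
proof
  fix X Y Z W :: "('i, 'o, 'm) inv_system" and f g h
  have obj: "X \<in> Obj (Pro C) \<longleftrightarrow> inverse_system C X" for X :: "('i, 'o, 'm) inv_system"
    by (simp add: Pro_def)
  have id: "Ident (Pro C) X = sys_equiv C X X `` {sys_ident C X}" for X :: "('i, 'o, 'm) inv_system"
    by (simp add: Pro_def)
  note in_PC = obj Hom_Pro id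
  have comp_in: "sys_compose C X Y Z G F \<in> sys_morphisms C X Z"
    if "inverse_system C X" "inverse_system C Y" "inverse_system C Z"
       "F \<in> sys_morphisms C X Y" "G \<in> sys_morphisms C Y Z" for X Y Z F G
    using that sys_compose_in by (cases F; cases G) blast
  show "Ident (Pro C) X \<in> Hom (Pro C) X X" if "X \<in> Obj (Pro C)"
    using that sys_ident_in unfolding in_PC by blast
  show "Compose (Pro C) X Y Z g f \<in> Hom (Pro C) X Z"
    if H: "X \<in> Obj (Pro C)" "Y \<in> Obj (Pro C)" "Z \<in> Obj (Pro C)"
      "f \<in> Hom (Pro C) X Y" "g \<in> Hom (Pro C) Y Z"
  proof -
    have X: "inverse_system C X" and Y: "inverse_system C Y" and Z: "inverse_system C Z"
      using H obj by auto
    obtain F G where f: "f = sys_equiv C X Y `` {F}" "F \<in> sys_morphisms C X Y"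
      and g: "g = sys_equiv C Y Z `` {G}" "G \<in> sys_morphisms C Y Z"
      using H(4,5) unfolding Hom_Pro by blast
    show ?thesis
      using Compose_Pro[OF X Y Z f(2) g(2)] comp_in[OF X Y Z f(2) g(2)]
      unfolding Hom_Pro f(1) g(1) by blast
  qed
  show "Compose (Pro C) X Y Y (Ident (Pro C) Y) f = f"
    if H: "X \<in> Obj (Pro C)" "Y \<in> Obj (Pro C)" "f \<in> Hom (Pro C) X Y"
  proof -
    have X: "inverse_system C X" and Y: "inverse_system C Y" using H obj by auto
    obtain a \<phi> where f: "f = sys_equiv C X Y `` {(a, \<phi>)}" and F: "(a, \<phi>) \<in> sys_morphisms C X Y"
      using H unfolding Hom_Pro by fast
    have "(sys_compose C X Y Y (sys_ident C Y) (a, \<phi>), (a, \<phi>)) \<in> sys_equiv C X Y"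
      using comp_in[OF X Y Y F sys_ident_in[OF Y]] F X Y
      unfolding sys_compose_def sys_ident_def
      by (auto intro!: sys_equivI ident_left simp: sys_morphisms_def inverse_system_def)
    then show ?thesis
      using Compose_Pro[OF X Y Y F sys_ident_in[OF Y]] sys_class_eqI[OF X Y] by (simp add: f id)
  qed
  show "Compose (Pro C) X X Y f (Ident (Pro C) X) = f"
    if H: "X \<in> Obj (Pro C)" "Y \<in> Obj (Pro C)" "f \<in> Hom (Pro C) X Y"
  proof -
    have X: "inverse_system C X" and Y: "inverse_system C Y" using H obj by auto
    obtain a \<phi> where f: "f = sys_equiv C X Y `` {(a, \<phi>)}" and F: "(a, \<phi>) \<in> sys_morphisms C X Y"
      using H unfolding Hom_Pro by fast
    have "(sys_compose C X X Y (a, \<phi>) (sys_ident C X), (a, \<phi>)) \<in> sys_equiv C X Y"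
      using comp_in[OF X X Y sys_ident_in[OF X] F] F X Y
      unfolding sys_compose_def sys_ident_def
      by (auto intro!: sys_equivI ident_right simp: sys_morphisms_def inverse_system_def)
    then show ?thesis
      using Compose_Pro[OF X X Y sys_ident_in[OF X] F] sys_class_eqI[OF X Y] by (simp add: f id)
  qed
  show "Compose (Pro C) W X Z (Compose (Pro C) X Y Z h g) f
      = Compose (Pro C) W Y Z h (Compose (Pro C) W X Y g f)"
    if H: "W \<in> Obj (Pro C)" "X \<in> Obj (Pro C)" "Y \<in> Obj (Pro C)" "Z \<in> Obj (Pro C)"
      "f \<in> Hom (Pro C) W X" "g \<in> Hom (Pro C) X Y" "h \<in> Hom (Pro C) Y Z"
  proof -
    have W: "inverse_system C W" and X: "inverse_system C X"
      and Y: "inverse_system C Y" and Z: "inverse_system C Z"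
      using H obj by auto
    obtain a \<phi> where f: "f = sys_equiv C W X `` {(a, \<phi>)}" and F: "(a, \<phi>) \<in> sys_morphisms C W X"
      using H unfolding Hom_Pro by fast
    obtain b \<psi> where g: "g = sys_equiv C X Y `` {(b, \<psi>)}" and G: "(b, \<psi>) \<in> sys_morphisms C X Y"
      using H unfolding Hom_Pro by fast
    obtain c \<theta> where h: "h = sys_equiv C Y Z `` {(c, \<theta>)}" and H: "(c, \<theta>) \<in> sys_morphisms C Y Z"
      using H unfolding Hom_Pro by fast
    note GF = comp_in[OF W X Y F G] and HG = comp_in[OF X Y Z G H]
    have eq: "Compose C (space_at W (\<phi> (\<psi> (\<theta> n)))) (space_at X (\<psi> (\<theta> n))) (space_at Z n)
          (Compose C (space_at X (\<psi> (\<theta> n))) (space_at Y (\<theta> n)) (space_at Z n) (c n) (b (\<theta> n)))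
          (a (\<psi> (\<theta> n))) =
        Compose C (space_at W (\<phi> (\<psi> (\<theta> n)))) (space_at Y (\<theta> n)) (space_at Z n) (c n)
          (Compose C (space_at W (\<phi> (\<psi> (\<theta> n)))) (space_at X (\<psi> (\<theta> n))) (space_at Y (\<theta> n))
            (b (\<theta> n)) (a (\<psi> (\<theta> n))))" if "n \<in> idx Z" for n
      using that F G H W X Y Z
      by (intro assoc) (auto simp: sys_morphisms_def inverse_system_def)
    have "(sys_compose C W X Z (sys_compose C X Y Z (c, \<theta>) (b, \<psi>)) (a, \<phi>),
        sys_compose C W Y Z (c, \<theta>) (sys_compose C W X Y (b, \<psi>) (a, \<phi>))) \<in> sys_equiv C W Z"
      using comp_in[OF W X Z F HG] comp_in[OF W Y Z GF H] eq
      unfolding sys_compose_def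
      by (auto intro!: sys_equivI[OF W] simp: o_assoc)
    then show ?thesis
      using sys_class_eqI[OF W Z]
      by (simp add: f g h Compose_Pro[OF X Y Z G H] Compose_Pro[OF W X Y F G]
          Compose_Pro[OF W X Z F HG] Compose_Pro[OF W Y Z GF H])
  qed
qed

end

lemma iterated_bond_add:
  "iterated_bond q m (k + j) = iterated_bond q m k \<circ> iterated_bond q (m + k) j"
  by (induction j) (simp_all add: o_assoc add.assoc)

lemma iterated_bond_continuous:
  assumes "\<And>n. n \<ge> 1 \<Longrightarrow> continuous_map (T (Suc n)) (T n) (q n)" "m \<ge> 1"
  shows "continuous_map (T (m + k)) (T m) (iterated_bond q m k)"
proof (induction k)
  case (Suc k)
  then show ?case
    using assms continuous_map_compose[of "T (Suc (m + k))" "T (m + k)" "q (m + k)"]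
    by (simp del: o_apply)
qed simp

lemma inverse_system_htop_sequence:
  assumes q: "\<And>n. n \<ge> 1 \<Longrightarrow> continuous_map (T (Suc n)) (T n) (q n)"
  shows "inverse_system HTop (htop_sequence T q)"
proof -
  have c: "continuous_map (T n) (T m) (iterated_bond q m (n - m))" if "1 \<le> m" "m \<le> n" for m n
    using iterated_bond_continuous[of T q m "n - m", OF q] that by simp
  have "Compose HTop (T k) (T j) (T i) (homotopy_class (T j) (T i) (iterated_bond q i (j - i)))
      (homotopy_class (T k) (T j) (iterated_bond q j (k - j))) =
      homotopy_class (T k) (T i) (iterated_bond q i (k - i))" if "1 \<le> i" "i \<le> j" "j \<le> k" for i j k
    using that iterated_bond_add[of q i "j - i" "k - j"] c by (simp add: Compose_HTop)
  moreover have "homotopy_class (T n) (T m) (iterated_bond q m (n - m)) \<in> Hom HTop (T n) (T m)"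
    if "1 \<le> m" "m \<le> n" for m n
    using c that unfolding Hom_HTop by blast
  moreover have "\<exists>k\<in>{Suc 0..}. i \<le> k \<and> j \<le> k" for i j :: nat
    by (rule bexI[of _ "Suc (i + j)"]) auto
  ultimately show ?thesis
    unfolding inverse_system_def directed_set_def htop_sequence_def
    by (auto simp: HTop_def)
qed

lemma continuous_map_q_map:
  assumes A: "approximation X \<epsilon> A" and B: "B \<subseteq> X" "finite B" and \<delta>: "\<delta> \<le> \<epsilon> / 2"
  shows "continuous_map (U_space (4 * \<delta>) B) (U_space (4 * \<epsilon>) A) (q_map \<epsilon> A)"
proof -
  have in_U: "q_map \<epsilon> A C \<in> U_set (4 * \<epsilon>) A" if C: "C \<in> U_set (4 * \<delta>) B" for C
  proof -
    have C': "C \<noteq> {}" "C \<subseteq> B" "finite C" "diameter C < 4 * \<delta>"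
      using C B finite_subset by (auto simp: U_set_def)
    have "finite (q_map \<epsilon> A C)" "q_map \<epsilon> A C \<subseteq> A"
      using A by (auto simp: q_map_def approximation_def intro: finite_subset[of _ A])
    have ne: "q_map \<epsilon> A C \<noteq> {}"
    proof -
      obtain x where x: "x \<in> C" "x \<in> X" using C' B by blast
      then obtain a where "a \<in> A" "dist x a < \<epsilon>"
        using A by (auto simp: approximation_def)
      with x have "a \<in> q_map \<epsilon> A C" by (auto simp: q_map_def)
      then show ?thesis by blast
    qed
    obtain a b where ab: "a \<in> q_map \<epsilon> A C" "b \<in> q_map \<epsilon> A C" "dist a b = diameter (q_map \<epsilon> A C)"
      using diameter_compact_attained[of "q_map \<epsilon> A C"] ne \<open>finite (q_map \<epsilon> A C)\<close>
      by (auto simp: finite_imp_compact)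
    then obtain x y where xy: "x \<in> C" "y \<in> C" "dist x a < \<epsilon>" "dist y b < \<epsilon>"
      by (auto simp: q_map_def)
    have "dist x y \<le> diameter C"
      using diameter_bounded_bound[of C x y] xy C' by (simp add: finite_imp_bounded)
    moreover have "dist a b \<le> dist x a + dist x y + dist y b"
      using dist_triangle[of a b x] dist_triangle[of x b y] by (simp add: dist_commute)
    ultimately show ?thesis
      using ab xy C' \<delta> ne \<open>q_map \<epsilon> A C \<subseteq> A\<close> by (auto simp: U_set_def)
  qed
  have "U_lower (4 * \<delta>) B {C \<in> U_set (4 * \<delta>) B. q_map \<epsilon> A C \<in> S}" if "U_lower (4 * \<epsilon>) A S" for S
  proof -
    have "U_le (q_map \<epsilon> A C) (q_map \<epsilon> A D)" if "U_le C D" for C D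
      using that by (auto simp: U_le_def q_map_def)
    then show ?thesis
      using that in_U unfolding U_lower_def by blast
  qed
  then show ?thesis
    unfolding continuous_map_def openin_U_space topspace_U_space using in_U by blast
qed

lemma FASO_half:
  assumes "FASO X \<epsilon> A" "X \<noteq> {}" "n \<ge> 1"
  shows "\<epsilon> (Suc n) \<le> \<epsilon> n / 2"
proof -
  obtain x where x: "x \<in> X" using assms by blast
  have "infdist y (A n) \<le> \<epsilon> n" if y: "y \<in> X" for y
  proof -
    obtain a where "a \<in> A n" "dist y a < \<epsilon> n"
      using assms(1,3) y unfolding FASO_def approximation_def by blast
    then show ?thesis by (meson infdist_le less_imp_le order_trans)
  qed
  then have "infdist x (A n) \<le> covering_radius X (A n)"
    unfolding covering_radius_def using x by (meson cSUP_upper bdd_aboveI2)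
  then have "covering_radius X (A n) \<ge> 0"
    using infdist_nonneg[of x "A n"] by linarith
  moreover have "\<epsilon> (Suc n) < (\<epsilon> n - covering_radius X (A n)) / 2"
    using assms(1,3) unfolding FASO_def by blast
  ultimately show ?thesis by (simp add: field_simps)
qed

theorem inverse_system_FASO:
  assumes "FASO X \<epsilon> A" "X \<noteq> {}"
  shows "inverse_system HTop (FASO_system \<epsilon> A)"
  unfolding FASO_system_def
proof (rule inverse_system_htop_sequence)
  fix n :: nat assume "n \<ge> 1"
  then show "continuous_map (U_space (4 * \<epsilon> (Suc n)) (A (Suc n))) (U_space (4 * \<epsilon> n) (A n))
      (q_map (\<epsilon> n) (A n))"
    using assms FASO_half[OF assms]
    by (intro continuous_map_q_map[of X]) (auto simp: FASO_def approximation_def)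
qed

end

theory Submission
  imports Defs
begin

text \<open>
  The bonding map formula \<open>C \<mapsto> \<Union>x\<in>C. ball x (\<delta> m) \<inter> B m\<close> also makes sense on
  \<open>U_set (4 * \<epsilon> n) (A n)\<close> whenever \<open>\<epsilon> n\<close> is small compared with \<open>\<delta> m\<close>, and it gives the morphisms
  in both directions. All the diagrams commute up to homotopy for one reason: two continuous maps
  \<open>f, g\<close> into \<open>U_space s B\<close> are homotopic, via \<open>f \<union> g\<close>, as soon as every point of \<open>f C\<close> is at distance
  less than \<open>s\<close> from every point of \<open>g C\<close>. The diameters of \<open>f C\<close> and \<open>g C\<close> themselves need not be
  estimated. A composite of bonding maps into level \<open>m\<close> moves points by less than
  \<open>2 * \<epsilon> m\<close>, because the \<open>\<epsilon> n\<close> at least halve at each step, and a single map into level \<open>m\<close> moves them by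
  less than \<open>\<epsilon> m\<close>; so the cross distances stay below \<open>3 * \<epsilon> m\<close> plus terms from much finer levels.
\<close>

section \<open>Homotopies between maps of the spaces \<open>U_space r A\<close>\<close>

text \<open>The open sets are the families of members closed under passing to larger members.
  Continuity therefore means monotonicity for inclusion, as for all Alexandrov spaces.\<close>

lemma continuous_map_U_space_iff:
  "continuous_map (U_space r A) (U_space s B) f \<longleftrightarrow>
     f ` U_set r A \<subseteq> U_set s B \<and>
     (\<forall>C\<in>U_set r A. \<forall>D\<in>U_set r A. C \<subseteq> D \<longrightarrow> f C \<subseteq> f D)" (is "?c \<longleftrightarrow> ?m")
proof
  assume c: ?c
  have im: "f ` U_set r A \<subseteq> U_set s B"
    using continuous_map_image_subset_topspace[OF c] by (simp add: topspace_U_space)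
  have "f C \<subseteq> f D" if CD: "C \<in> U_set r A" "D \<in> U_set r A" "C \<subseteq> D" for C D
  proof -
    \<comment> \<open>This family is the smallest open set containing \<open>f C\<close>. Its
      preimage is open and contains \<open>C\<close>, hence also every larger member
      \<open>D\<close>.\<close>
    have "U_lower s B {E \<in> U_set s B. f C \<subseteq> E}"
      by (auto simp: U_lower_def U_le_def)
    then have "U_lower r A {x \<in> U_set r A. f x \<in> {E \<in> U_set s B. f C \<subseteq> E}}"
      using c unfolding continuous_map_def openin_U_space topspace_U_space by blast
    moreover have "C \<in> {x \<in> U_set r A. f x \<in> {E \<in> U_set s B. f C \<subseteq> E}}"
      using CD im by auto
    ultimately have "D \<in> {x \<in> U_set r A. f x \<in> {E \<in> U_set s B. f C \<subseteq> E}}"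
      using CD unfolding U_lower_def U_le_def by blast
    then show ?thesis by simp
  qed
  with im show ?m by simp
next
  assume m: ?m
  have "U_lower r A {x \<in> U_set r A. f x \<in> S}" if "U_lower s B S" for S
    unfolding U_lower_def U_le_def
  proof (intro conjI ballI impI)
    fix C D assume "C \<in> {x \<in> U_set r A. f x \<in> S}" "D \<in> U_set r A" "C \<subseteq> D"
    then have "f C \<in> S" "f D \<in> U_set s B" "f C \<subseteq> f D" "D \<in> U_set r A"
      using m by auto
    then show "D \<in> {x \<in> U_set r A. f x \<in> S}"
      using that unfolding U_lower_def U_le_def by simp
  qed simp
  moreover have "f \<in> U_set r A \<rightarrow> U_set s B"
    using m by auto
  ultimately show ?c
    unfolding continuous_map_def openin_U_space topspace_U_space by simp
qed

text \<open>A homotopy jumping from the smaller map to the larger one right after time 0 is continuous.\<close>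

lemma homotopic_with_subset_U_space:
  assumes f: "continuous_map X (U_space s B) f" and g: "continuous_map X (U_space s B) g"
    and le: "\<And>x. x \<in> topspace X \<Longrightarrow> f x \<subseteq> g x"
  shows "homotopic_with (\<lambda>_. True) X (U_space s B) f g"
proof -
  define h where "h = (\<lambda>(t::real, x). if t = 0 then f x else g x)"
  let ?I = "top_of_set {0..1::real}"
  have fg: "f x \<in> U_set s B" "g x \<in> U_set s B" if "x \<in> topspace X" for x
    using that continuous_map_image_subset_topspace[OF f] continuous_map_image_subset_topspace[OF g]
    by (auto simp: topspace_U_space)
  have "openin (prod_topology ?I X) {p \<in> topspace (prod_topology ?I X). h p \<in> S}"
    if S: "openin (U_space s B) S" for S
  proof -
    have up: "g x \<in> S" if "x \<in> topspace X" "f x \<in> S" for x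
      using S that fg le unfolding openin_U_space U_lower_def U_le_def by blast
    \<comment> \<open>By \<open>up\<close>, allowing \<open>f x \<in> S\<close> at all times instead
      of only at time 0 adds no points. The preimage of \<open>S\<close> becomes a union of two open
      boxes.\<close>
    have "h (t, x) \<in> S \<longleftrightarrow> f x \<in> S \<or> (t \<noteq> 0 \<and> g x \<in> S)" if "x \<in> topspace X" for t x
      using up[OF that] by (auto simp: h_def)
    then have "{p \<in> topspace (prod_topology ?I X). h p \<in> S} =
        ({0<..1} \<times> {x \<in> topspace X. g x \<in> S}) \<union> ({0..1} \<times> {x \<in> topspace X. f x \<in> S})"
      by (auto simp: topspace_prod_topology)
    moreover have I: "openin ?I {0<..1}"
    proof -
      have "{0<..1} = {0..1} \<inter> {0::real<..}" by auto
      then show ?thesis using openin_open_Int[OF open_greaterThan] by metis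
    qed
    moreover have "openin (prod_topology ?I X) ({0<..1} \<times> {x \<in> topspace X. g x \<in> S})"
      unfolding openin_prod_Times_iff using I openin_continuous_map_preimage[OF g S] by simp
    moreover have "openin (prod_topology ?I X) ({0..1} \<times> {x \<in> topspace X. f x \<in> S})"
      unfolding openin_prod_Times_iff
      using openin_topspace[of ?I] openin_continuous_map_preimage[OF f S] by simp
    ultimately show ?thesis
      by (simp add: openin_Un)
  qed
  then have "continuous_map (prod_topology ?I X) (U_space s B) h"
    using fg by (auto simp: continuous_map_def topspace_U_space h_def)
  then show ?thesis
    unfolding homotopic_with_def by (intro exI[of _ h]) (simp add: h_def)
qed

text \<open>The bound runs only from points of the image back to the argument, and it is imposed on
  all sets rather than on the members of one space. It thus composes without side conditions and
  holds for one formula on several domains.\<close>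

definition displacement_less :: "real \<Rightarrow> ('a::metric_space set \<Rightarrow> 'a set) \<Rightarrow> bool" where
  "displacement_less t f \<longleftrightarrow> (\<forall>C. \<forall>y\<in>f C. \<exists>x\<in>C. dist x y < t)"

lemma displacement_lessD: "displacement_less t f \<Longrightarrow> y \<in> f C \<Longrightarrow> \<exists>x\<in>C. dist x y < t"
  by (simp add: displacement_less_def)

lemma displacement_less_id: "0 < t \<Longrightarrow> displacement_less t id"
  unfolding displacement_less_def by (metis dist_self id_apply)

lemma displacement_less_mono: "displacement_less s f \<Longrightarrow> s \<le> t \<Longrightarrow> displacement_less t f"
  unfolding displacement_less_def by (meson order_less_le_trans)

lemma displacement_less_compose:
  assumes f: "displacement_less s f" and g: "displacement_less t g"
  shows "displacement_less (t + s) (g \<circ> f)"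
  unfolding displacement_less_def
proof (intro allI ballI)
  fix C z assume "z \<in> (g \<circ> f) C"
  then have "z \<in> g (f C)" by simp
  then obtain y where y: "y \<in> f C" "dist y z < t"
    using displacement_lessD[OF g] by blast
  obtain x where "x \<in> C" "dist x y < s"
    using displacement_lessD[OF f y(1)] by blast
  with y show "\<exists>x\<in>C. dist x z < t + s"
    using dist_triangle[of x z y] by (intro bexI[of _ x]) auto
qed

lemma displacement_less_q_map: "displacement_less \<epsilon> (q_map \<epsilon> A)"
  by (auto simp: displacement_less_def q_map_def)

text \<open>The union lies above both maps, so each is homotopic to it by a jump. Its values have
  diameter below \<open>s\<close>: two points of the same image are close because that image is
  already a member of \<open>U_set s B\<close>, and a mixed pair is joined through two points of
  \<open>C\<close> at cost less than \<open>a + r + b\<close>.\<close>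

lemma homotopic_with_displacement_less:
  assumes fin: "finite A" "finite B"
    and f: "continuous_map (U_space r A) (U_space s B) f" "displacement_less a f"
    and g: "continuous_map (U_space r A) (U_space s B) g" "displacement_less b g"
    and le: "a + b + r \<le> s"
  shows "homotopic_with (\<lambda>_. True) (U_space r A) (U_space s B) f g"
proof -
  let ?h = "\<lambda>C. f C \<union> g C"
  have h_in: "?h C \<in> U_set s B" if C: "C \<in> U_set r A" for C
  proof -
    have "finite C" using C fin finite_subset by (auto simp: U_set_def)
    have U: "f C \<in> U_set s B" "g C \<in> U_set s B"
      using C f g by (auto simp: continuous_map_U_space_iff)
    then have fin': "finite (f C)" "finite (g C)" and ne: "?h C \<noteq> {}"
      using fin finite_subset by (auto simp: U_set_def)
    have cross: "dist y z < s" if yz: "y \<in> f C" "z \<in> g C" for y z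
    proof -
      obtain x where x: "x \<in> C" "dist x y < a"
        using displacement_lessD[OF f(2) yz(1)] by blast
      obtain x' where x': "x' \<in> C" "dist x' z < b"
        using displacement_lessD[OF g(2) yz(2)] by blast
      have "dist x x' < r"
        using diameter_bounded_bound[of C x x'] x x' C \<open>finite C\<close>
        by (auto simp: finite_imp_bounded U_set_def)
      moreover have "dist y z \<le> dist x y + dist x x' + dist x' z"
        using dist_triangle[of y z x] dist_triangle[of x z x'] by (simp add: dist_commute)
      ultimately show ?thesis using x x' le by linarith
    qed
    have inner: "dist y z < s" if "E \<in> U_set s B" "finite E" "y \<in> E" "z \<in> E" for E y z
      using diameter_bounded_bound[of E y z] that by (auto simp: finite_imp_bounded U_set_def)
    \<comment> \<open>A nonempty finite set attains its diameter, so strict bounds on distances give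
      a strict bound on the diameter.\<close>
    obtain y z where yz: "y \<in> ?h C" "z \<in> ?h C" "dist y z = diameter (?h C)"
      using diameter_compact_attained[of "?h C"] ne fin' by (auto simp: finite_imp_compact)
    have "dist y z < s"
      using yz(1,2) cross[of y z] cross[of z y] inner[OF U(1) fin'(1), of y z]
        inner[OF U(2) fin'(2), of y z] by (auto simp: dist_commute)
    then show ?thesis
      using U ne yz by (auto simp: U_set_def)
  qed
  have h: "continuous_map (U_space r A) (U_space s B) ?h"
    unfolding continuous_map_U_space_iff
  proof (intro conjI ballI impI)
    show "?h ` U_set r A \<subseteq> U_set s B" using h_in by (rule image_subsetI)
    show "?h C \<subseteq> ?h D" if "C \<in> U_set r A" "D \<in> U_set r A" "C \<subseteq> D" for C D
      using that f(1) g(1) unfolding continuous_map_U_space_iff by (intro Un_mono) simp_all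
  qed
  have fgh: "homotopic_with (\<lambda>_. True) (U_space r A) (U_space s B) f ?h"
    "homotopic_with (\<lambda>_. True) (U_space r A) (U_space s B) g ?h"
    by (rule homotopic_with_subset_U_space[OF f(1) h] homotopic_with_subset_U_space[OF g(1) h]; simp)+
  show ?thesis
    using homotopic_with_trans[OF fgh(1) homotopic_with_symD[OF fgh(2)]] .
qed


section \<open>The morphism between two FASOs\<close>

lemma FASO_approximation: "FASO X \<epsilon> A \<Longrightarrow> n \<ge> 1 \<Longrightarrow> approximation X (\<epsilon> n) (A n)"
  by (simp add: FASO_def)

lemma FASO_pos: "FASO X \<epsilon> A \<Longrightarrow> n \<ge> 1 \<Longrightarrow> \<epsilon> n > 0"
  using FASO_approximation unfolding approximation_def by blast

lemma FASO_finite: "FASO X \<epsilon> A \<Longrightarrow> n \<ge> 1 \<Longrightarrow> finite (A n)"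
  using FASO_approximation unfolding approximation_def by blast

lemma FASO_antimono:
  assumes "FASO X \<epsilon> A" "X \<noteq> {}" "1 \<le> m" "m \<le> n"
  shows "\<epsilon> n \<le> \<epsilon> m"
  using assms(4)
proof (induction n rule: dec_induct)
  case (step n)
  then have "\<epsilon> (Suc n) \<le> \<epsilon> n / 2" "\<epsilon> n > 0"
    using FASO_half[OF assms(1,2)] FASO_pos[OF assms(1)] assms(3) by auto
  with step show ?case by linarith
qed simp

lemma FASO_arbitrarily_small:
  assumes "FASO X \<epsilon> A" "X \<noteq> {}" "t > 0"
  shows "\<exists>n\<ge>1. \<epsilon> n \<le> t"
proof -
  have *: "\<epsilon> (Suc n) \<le> \<epsilon> 1 * (1/2) ^ n" for n
  proof (induction n)
    case (Suc n)
    then show ?case using FASO_half[OF assms(1,2), of "Suc n"] by simp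
  qed simp
  have "\<epsilon> 1 > 0" using FASO_pos assms(1) by blast
  then obtain n where "(1/2) ^ n < t / \<epsilon> 1"
    using real_arch_pow_inv[of "t / \<epsilon> 1" "1/2"] assms(3) by auto
  then have "\<epsilon> 1 * (1/2) ^ n < t"
    using \<open>\<epsilon> 1 > 0\<close> by (simp add: field_simps)
  then show ?thesis
    using *[of n] by (intro exI[of _ "Suc n"]) auto
qed

abbreviation U_level :: "(nat \<Rightarrow> real) \<Rightarrow> (nat \<Rightarrow> 'a::metric_space set) \<Rightarrow> nat \<Rightarrow> 'a set topology" where
  "U_level \<epsilon> A n \<equiv> U_space (4 * \<epsilon> n) (A n)"

abbreviation q_bond :: "(nat \<Rightarrow> real) \<Rightarrow> (nat \<Rightarrow> 'a::metric_space set) \<Rightarrow> nat \<Rightarrow> nat \<Rightarrow> 'a set \<Rightarrow> 'a set" where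
  "q_bond \<epsilon> A m n \<equiv> iterated_bond (\<lambda>n. q_map (\<epsilon> n) (A n)) m (n - m)"

lemma FASO_system_simps [simp]:
  "idx (FASO_system \<epsilon> A) = {1..}"
  "le (FASO_system \<epsilon> A) = (\<le>)"
  "space_at (FASO_system \<epsilon> A) n = U_level \<epsilon> A n"
  "bond (FASO_system \<epsilon> A) m n = homotopy_class (U_level \<epsilon> A n) (U_level \<epsilon> A m) (q_bond \<epsilon> A m n)"
  by (simp_all add: FASO_system_def htop_sequence_def)

lemma continuous_map_q_bond:
  assumes "FASO X \<epsilon> A" "X \<noteq> {}" "1 \<le> m" "m \<le> n"
  shows "continuous_map (U_level \<epsilon> A n) (U_level \<epsilon> A m) (q_bond \<epsilon> A m n)"
proof -
  have "continuous_map (U_level \<epsilon> A (Suc n)) (U_level \<epsilon> A n) (q_map (\<epsilon> n) (A n))" if "n \<ge> 1" for n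
    using assms that FASO_half[OF assms(1,2) that]
    by (intro continuous_map_q_map[of X]) (auto simp: FASO_def approximation_def)
  then show ?thesis
    using iterated_bond_continuous[of "U_level \<epsilon> A" "\<lambda>n. q_map (\<epsilon> n) (A n)" m "n - m"] assms by simp
qed

text \<open>The outermost map costs \<open>\<epsilon> m\<close>. The others form a composite into
  level \<open>Suc m\<close>, which costs \<open>2 * \<epsilon> (Suc m) \<le> \<epsilon> m\<close>
  by induction; hence the generalization over \<open>m\<close>.\<close>

lemma displacement_less_iterated_bond:
  assumes "FASO X \<epsilon> A" "X \<noteq> {}" "1 \<le> m"
  shows "displacement_less (2 * \<epsilon> m) (iterated_bond (\<lambda>n. q_map (\<epsilon> n) (A n)) m k)"
  using assms(3)
proof (induction k arbitrary: m)
  case 0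
  then show ?case using FASO_pos[OF assms(1)] displacement_less_id[of "2 * \<epsilon> m"] by (simp add: id_def)
next
  case (Suc k)
  let ?q = "\<lambda>n. q_map (\<epsilon> n) (A n)"
  have "displacement_less (\<epsilon> m + 2 * \<epsilon> (Suc m)) (?q m \<circ> iterated_bond ?q (Suc m) k)"
    using Suc by (intro displacement_less_compose displacement_less_q_map) simp
  \<comment> \<open>The recursion of \<open>iterated_bond\<close> splits off the innermost map;
    additivity with a first block of length 1 splits off the outermost one.\<close>
  moreover have "iterated_bond ?q m (Suc k) = ?q m \<circ> iterated_bond ?q (Suc m) k"
    using iterated_bond_add[of ?q m 1 k] by simp
  ultimately have "displacement_less (\<epsilon> m + 2 * \<epsilon> (Suc m)) (iterated_bond ?q m (Suc k))"
    by (simp only:)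
  then show ?case
    by (rule displacement_less_mono) (use FASO_half[OF assms(1,2) Suc.prems] in simp)
qed

section \<open>Comparison morphisms between two FASOs and their composites\<close>

definition FASO_mor :: "(nat \<Rightarrow> real) \<Rightarrow> (nat \<Rightarrow> 'a::metric_space set) \<Rightarrow> (nat \<Rightarrow> real) \<Rightarrow> (nat \<Rightarrow> 'a set)
    \<Rightarrow> (nat \<Rightarrow> nat) \<Rightarrow> (nat, nat, ('a set \<Rightarrow> 'a set) set) sys_mor" where
  "FASO_mor \<epsilon> A \<delta> B \<phi> =
     ((\<lambda>m. homotopy_class (U_level \<epsilon> A (\<phi> m)) (U_level \<delta> B m) (q_map (\<delta> m) (B m))), \<phi>)"

text \<open>The factor 8 is set by the estimate in \<open>FASO_mor_in\<close>, where eight terms of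
  the finer scale must fit into one \<open>\<delta> m\<close>. It also gives
  \<open>\<epsilon> (\<phi> m) \<le> \<delta> m / 2\<close>, the condition for continuity of
  \<open>q_map\<close>.\<close>

definition FASO_refines :: "(nat \<Rightarrow> real) \<Rightarrow> (nat \<Rightarrow> real) \<Rightarrow> (nat \<Rightarrow> nat) \<Rightarrow> bool" where
  "FASO_refines \<epsilon> \<delta> \<phi> \<longleftrightarrow> (\<forall>m\<ge>1. \<phi> m \<ge> 1 \<and> 8 * \<epsilon> (\<phi> m) \<le> \<delta> m)"

lemma FASO_refines_exists:
  assumes "X \<noteq> {}" "FASO X \<epsilon> A" "FASO X \<delta> B"
  obtains \<phi> where "FASO_refines \<epsilon> \<delta> \<phi>"
proof -
  have "\<exists>n\<ge>1. 8 * \<epsilon> n \<le> \<delta> m" if "m \<ge> 1" for m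
    using FASO_arbitrarily_small[OF assms(2,1), of "\<delta> m / 8"] FASO_pos[OF assms(3) that] by auto
  then show thesis
    using that unfolding FASO_refines_def by metis
qed

context
  fixes X :: "'a::metric_space set" and \<epsilon> \<delta> :: "nat \<Rightarrow> real" and A B :: "nat \<Rightarrow> 'a set"
    and \<phi> :: "nat \<Rightarrow> nat"
  assumes ne: "X \<noteq> {}" and A: "FASO X \<epsilon> A" and B: "FASO X \<delta> B" and \<phi>: "FASO_refines \<epsilon> \<delta> \<phi>"
begin

lemma continuous_map_q_map_FASO:
  assumes "m \<ge> 1"
  shows "continuous_map (U_level \<epsilon> A (\<phi> m)) (U_level \<delta> B m) (q_map (\<delta> m) (B m))"
proof -
  have "\<phi> m \<ge> 1" "8 * \<epsilon> (\<phi> m) \<le> \<delta> m"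
    using \<phi> assms by (auto simp: FASO_refines_def)
  then show ?thesis
    using FASO_approximation[OF B assms] FASO_approximation[OF A] FASO_pos[OF A, of "\<phi> m"]
    by (intro continuous_map_q_map[of X]) (auto simp: approximation_def)
qed

text \<open>Exhibits an explicit continuous representative, so that equality of pulled-back
  morphisms reduces to a homotopy between maps with known displacement.\<close>

lemma pull_FASO_mor:
  assumes "m \<ge> 1" "\<phi> m \<le> l"
  shows "pull HTop (FASO_system \<epsilon> A) (FASO_system \<delta> B) (FASO_mor \<epsilon> A \<delta> B \<phi>) m l =
    homotopy_class (U_level \<epsilon> A l) (U_level \<delta> B m) (q_map (\<delta> m) (B m) \<circ> q_bond \<epsilon> A (\<phi> m) l)"
    and "continuous_map (U_level \<epsilon> A l) (U_level \<delta> B m)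
      (q_map (\<delta> m) (B m) \<circ> q_bond \<epsilon> A (\<phi> m) l)"
proof -
  have "\<phi> m \<ge> 1" using \<phi> assms by (simp add: FASO_refines_def)
  note c = continuous_map_q_bond[OF A ne this assms(2)] continuous_map_q_map_FASO[OF assms(1)]
  show "pull HTop (FASO_system \<epsilon> A) (FASO_system \<delta> B) (FASO_mor \<epsilon> A \<delta> B \<phi>) m l =
    homotopy_class (U_level \<epsilon> A l) (U_level \<delta> B m) (q_map (\<delta> m) (B m) \<circ> q_bond \<epsilon> A (\<phi> m) l)"
    using Compose_HTop[OF c] by (simp add: pull_def FASO_mor_def)
  show "continuous_map (U_level \<epsilon> A l) (U_level \<delta> B m)
      (q_map (\<delta> m) (B m) \<circ> q_bond \<epsilon> A (\<phi> m) l)"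
    using continuous_map_compose[OF c] .
qed

lemma FASO_mor_in: "FASO_mor \<epsilon> A \<delta> B \<phi> \<in> sys_morphisms HTop (FASO_system \<epsilon> A) (FASO_system \<delta> B)"
proof -
  let ?F = "FASO_mor \<epsilon> A \<delta> B \<phi>" and ?S = "FASO_system \<epsilon> A" and ?T = "FASO_system \<delta> B"
  have "\<exists>l\<ge>1. \<phi> m \<le> l \<and> \<phi> m' \<le> l \<and> pull HTop ?S ?T ?F m l =
      Compose HTop (U_level \<epsilon> A l) (U_level \<delta> B m') (U_level \<delta> B m)
        (homotopy_class (U_level \<delta> B m') (U_level \<delta> B m) (q_bond \<delta> B m m')) (pull HTop ?S ?T ?F m' l)"
    if m: "1 \<le> m" "m \<le> m'" for m m'
  proof -
    define l where "l = max (\<phi> m) (\<phi> m')"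
    have m': "1 \<le> m'" using m by simp
    have le: "\<phi> m \<le> l" "\<phi> m' \<le> l" and ge: "1 \<le> \<phi> m" "1 \<le> \<phi> m'" "1 \<le> l"
      and small: "8 * \<epsilon> (\<phi> m) \<le> \<delta> m" "8 * \<epsilon> (\<phi> m') \<le> \<delta> m'"
      using \<phi> m m' by (auto simp: l_def FASO_refines_def max_def)
    let ?f = "q_map (\<delta> m) (B m) \<circ> q_bond \<epsilon> A (\<phi> m) l"
      and ?g = "(q_bond \<delta> B m m' \<circ> q_map (\<delta> m') (B m')) \<circ> q_bond \<epsilon> A (\<phi> m') l"
    note c = pull_FASO_mor(2)[OF m(1) le(1)] pull_FASO_mor(2)[OF m' le(2)]
      continuous_map_q_bond[OF B ne m]
    have cg: "continuous_map (U_level \<epsilon> A l) (U_level \<delta> B m) ?g"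
      using continuous_map_compose[OF c(2,3)] by (simp add: o_assoc)
    \<comment> \<open>The comparison map into level \<open>m'\<close> has the formula of one more
      bonding map, so the whole composite costs only \<open>2 * \<delta> m\<close>. Charging an
      extra \<open>\<delta> m'\<close> would exceed the budget \<open>4 * \<delta> m\<close> when
      \<open>m' = m\<close>.\<close>
    have "q_bond \<delta> B m m' \<circ> q_map (\<delta> m') (B m') = iterated_bond (\<lambda>n. q_map (\<delta> n) (B n)) m (Suc (m' - m))"
      using m by simp
    then have "displacement_less (2 * \<delta> m) (q_bond \<delta> B m m' \<circ> q_map (\<delta> m') (B m'))"
      using displacement_less_iterated_bond[OF B ne m(1)] by metis
    then have "displacement_less (2 * \<delta> m + 2 * \<epsilon> (\<phi> m')) ?g"
      by (rule displacement_less_compose[OF displacement_less_iterated_bond[OF A ne ge(2)]])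
    moreover have "displacement_less (\<delta> m + 2 * \<epsilon> (\<phi> m)) ?f"
      by (rule displacement_less_compose[OF displacement_less_iterated_bond[OF A ne ge(1)]
            displacement_less_q_map])
    \<comment> \<open>The two paths use \<open>3 * \<delta> m\<close>. The scales at
      \<open>\<phi> m\<close>, \<open>\<phi> m'\<close> and \<open>l\<close> are each at most
      \<open>\<delta> m / 8\<close> and occur 2 + 2 + 4 times, which fills the remaining
      \<open>\<delta> m\<close>.\<close>
    moreover have "(\<delta> m + 2 * \<epsilon> (\<phi> m)) + (2 * \<delta> m + 2 * \<epsilon> (\<phi> m')) + 4 * \<epsilon> l \<le> 4 * \<delta> m"
      using small FASO_antimono[OF B ne m] FASO_antimono[OF A ne ge(1) le(1)] by linarith
    ultimately have "homotopic_with (\<lambda>_. True) (U_level \<epsilon> A l) (U_level \<delta> B m) ?f ?g"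
      by (intro homotopic_with_displacement_less[OF FASO_finite[OF A ge(3)] FASO_finite[OF B m(1)]
            c(1) _ cg])
    then have "homotopy_class (U_level \<epsilon> A l) (U_level \<delta> B m) ?f = homotopy_class (U_level \<epsilon> A l) (U_level \<delta> B m) ?g"
      using homotopy_class_eq_iff[OF c(1) cg] by blast
    then have "pull HTop ?S ?T ?F m l =
      Compose HTop (U_level \<epsilon> A l) (U_level \<delta> B m') (U_level \<delta> B m)
        (homotopy_class (U_level \<delta> B m') (U_level \<delta> B m) (q_bond \<delta> B m m')) (pull HTop ?S ?T ?F m' l)"
      using pull_FASO_mor(1)[OF m(1) le(1)] pull_FASO_mor(1)[OF m' le(2)] Compose_HTop[OF c(2,3)]
      by (simp add: o_assoc)
    then show ?thesis using le ge by blast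
  qed
  moreover have "\<phi> m \<ge> 1" "homotopy_class (U_level \<epsilon> A (\<phi> m)) (U_level \<delta> B m) (q_map (\<delta> m) (B m))
      \<in> Hom HTop (U_level \<epsilon> A (\<phi> m)) (U_level \<delta> B m)" if "m \<ge> 1" for m
    using \<phi> continuous_map_q_map_FASO[OF that] that by (auto simp: Hom_HTop FASO_refines_def)
  ultimately show ?thesis
    by (auto simp: sys_morphisms_def FASO_mor_def Bex_def)
qed

end

text \<open>At a common finer level, the round trip through the other FASO and the bonding map into
  level \<open>m\<close> both move points little enough to be homotopic. Exchanging the two FASOs
  yields the other composite.\<close>

lemma Compose_FASO_mor:
  assumes ne: "X \<noteq> {}" and A: "FASO X \<epsilon> A" and B: "FASO X \<delta> B"
    and \<phi>: "FASO_refines \<epsilon> \<delta> \<phi>" and \<psi>: "FASO_refines \<delta> \<epsilon> \<psi>"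
  defines "S \<equiv> FASO_system \<epsilon> A" and "T \<equiv> FASO_system \<delta> B"
  shows "Compose (Pro HTop) S T S
    (sys_equiv HTop T S `` {FASO_mor \<delta> B \<epsilon> A \<psi>}) (sys_equiv HTop S T `` {FASO_mor \<epsilon> A \<delta> B \<phi>})
    = Ident (Pro HTop) S"
proof -
  interpret category HTop by (rule category_HTop)
  have S: "inverse_system HTop S" and T: "inverse_system HTop T"
    using inverse_system_FASO A B ne by (auto simp: S_def T_def)
  have F: "FASO_mor \<epsilon> A \<delta> B \<phi> \<in> sys_morphisms HTop S T"
    and G: "FASO_mor \<delta> B \<epsilon> A \<psi> \<in> sys_morphisms HTop T S"
    using FASO_mor_in[OF ne A B \<phi>] FASO_mor_in[OF ne B A \<psi>] by (simp_all add: S_def T_def)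
  let ?GF = "sys_compose HTop S T S (FASO_mor \<delta> B \<epsilon> A \<psi>) (FASO_mor \<epsilon> A \<delta> B \<phi>)"
  define gf where "gf = (\<lambda>m. homotopy_class (U_level \<epsilon> A (\<phi> (\<psi> m))) (U_level \<epsilon> A m)
    (q_map (\<epsilon> m) (A m) \<circ> q_map (\<delta> (\<psi> m)) (B (\<psi> m))))"
  have idx: "\<psi> m \<ge> 1" "\<phi> (\<psi> m) \<ge> 1" if "m \<ge> 1" for m
    using that \<phi> \<psi> by (auto simp: FASO_refines_def)
  have cont: "continuous_map (U_level \<epsilon> A (\<phi> (\<psi> m))) (U_level \<delta> B (\<psi> m)) (q_map (\<delta> (\<psi> m)) (B (\<psi> m)))"
    "continuous_map (U_level \<delta> B (\<psi> m)) (U_level \<epsilon> A m) (q_map (\<epsilon> m) (A m))" if "m \<ge> 1" for m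
    using continuous_map_q_map_FASO[OF ne A B \<phi> idx(1)[OF that]]
      continuous_map_q_map_FASO[OF ne B A \<psi> that] by auto
  define h where "h = fst ?GF"
  define i where "i = fst (sys_ident HTop S)"
  \<comment> \<open>Restricted to \<open>m \<ge> 1\<close>, where the two factors are known to be
    continuous and \<open>Compose_HTop\<close> applies.\<close>
  have h: "h m = gf m" if "m \<ge> 1" for m
    using Compose_HTop[OF cont[OF that]]
    by (simp add: sys_compose_def FASO_mor_def S_def T_def gf_def h_def)
  have i: "i m = homotopy_class (U_level \<epsilon> A m) (U_level \<epsilon> A m) id" for m
    by (simp add: i_def sys_ident_def S_def HTop_def)
  have GF: "?GF = (h, \<phi> \<circ> \<psi>)" and id: "sys_ident HTop S = (i, id)"
    by (simp_all add: h_def i_def sys_compose_def sys_ident_def FASO_mor_def)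
  have in_mor: "(h, \<phi> \<circ> \<psi>) \<in> sys_morphisms HTop S S" "(i, id) \<in> sys_morphisms HTop S S"
    using sys_compose_in[OF S T S] F G sys_ident_in[OF S]
    unfolding GF[symmetric] id[symmetric] by (auto simp: FASO_mor_def)
  have "\<exists>l\<ge>1. (\<phi> \<circ> \<psi>) m \<le> l \<and> m \<le> l \<and>
      pull HTop S S (h, \<phi> \<circ> \<psi>) m l = pull HTop S S (i, id) m l" if m: "m \<ge> 1" for m
  proof -
    define l where "l = max (\<phi> (\<psi> m)) m"
    have le: "\<phi> (\<psi> m) \<le> l" "m \<le> l" and l: "1 \<le> l"
      using m by (auto simp: l_def)
    let ?f = "(q_map (\<epsilon> m) (A m) \<circ> q_map (\<delta> (\<psi> m)) (B (\<psi> m))) \<circ> q_bond \<epsilon> A (\<phi> (\<psi> m)) l"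
    note c = continuous_map_q_bond[OF A ne idx(2)[OF m] le(1)]
      continuous_map_compose[OF cont[OF m]] continuous_map_q_bond[OF A ne m le(2)]
    have cf: "continuous_map (U_level \<epsilon> A l) (U_level \<epsilon> A m) ?f"
      using continuous_map_compose[OF c(1,2)] .
    have "displacement_less ((\<epsilon> m + \<delta> (\<psi> m)) + 2 * \<epsilon> (\<phi> (\<psi> m))) ?f"
      by (rule displacement_less_compose[OF displacement_less_iterated_bond[OF A ne idx(2)[OF m]]
            displacement_less_compose[OF displacement_less_q_map displacement_less_q_map]])
    moreover have "displacement_less (2 * \<epsilon> m) (q_bond \<epsilon> A m l)"
      using displacement_less_iterated_bond[OF A ne m] .
    \<comment> \<open>The round trip and the bonding map use \<open>3 * \<epsilon> m\<close>. The
      rest is at most \<open>\<epsilon> m / 8\<close> plus six times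
      \<open>\<epsilon> m / 64\<close>, below \<open>\<epsilon> m\<close>.\<close>
    moreover have "((\<epsilon> m + \<delta> (\<psi> m)) + 2 * \<epsilon> (\<phi> (\<psi> m))) + 2 * \<epsilon> m + 4 * \<epsilon> l \<le> 4 * \<epsilon> m"
    proof -
      have "8 * \<delta> (\<psi> m) \<le> \<epsilon> m" "8 * \<epsilon> (\<phi> (\<psi> m)) \<le> \<delta> (\<psi> m)"
        using \<phi> \<psi> m idx[OF m] by (auto simp: FASO_refines_def)
      then show ?thesis
        using FASO_antimono[OF A ne idx(2)[OF m] le(1)] FASO_pos[OF A m] by linarith
    qed
    ultimately have "homotopic_with (\<lambda>_. True) (U_level \<epsilon> A l) (U_level \<epsilon> A m) ?f (q_bond \<epsilon> A m l)"
      by (intro homotopic_with_displacement_less[OF FASO_finite[OF A l] FASO_finite[OF A m] cf _ c(3)])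
    then have "homotopy_class (U_level \<epsilon> A l) (U_level \<epsilon> A m) ?f =
        homotopy_class (U_level \<epsilon> A l) (U_level \<epsilon> A m) (q_bond \<epsilon> A m l)"
      using homotopy_class_eq_iff[OF cf c(3)] by blast
    moreover have "pull HTop S S (h, \<phi> \<circ> \<psi>) m l = homotopy_class (U_level \<epsilon> A l) (U_level \<epsilon> A m) ?f"
      using Compose_HTop[OF c(1,2)] h[OF m] by (simp add: pull_def S_def gf_def)
    moreover have "pull HTop S S (i, id) m l =
        homotopy_class (U_level \<epsilon> A l) (U_level \<epsilon> A m) (q_bond \<epsilon> A m l)"
      using Compose_HTop[OF c(3) continuous_map_id] by (simp add: pull_def i S_def)
    ultimately show ?thesis using le l by auto
  qed
  then have "(?GF, sys_ident HTop S) \<in> sys_equiv HTop S S"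
    unfolding sys_equiv_def GF id using in_mor by (simp add: S_def Bex_def)
  then have "sys_equiv HTop S S `` {?GF} = sys_equiv HTop S S `` {sys_ident HTop S}"
    by (rule sys_class_eqI[OF S S])
  then show ?thesis
    using Compose_Pro[OF S T S F G] by (simp add: Pro_def)
qed

theorem theorem4p1:
  fixes X :: "'a::metric_space set"
    and \<epsilon> \<delta> :: "nat \<Rightarrow> real"
    and A B :: "nat \<Rightarrow> 'a set"
  assumes "compact X" and "X \<noteq> {}"
    and "FASO X \<epsilon> A" and "FASO X \<delta> B"
  shows "isomorphic (Pro HTop) (FASO_system \<epsilon> A) (FASO_system \<delta> B)"
proof -
  interpret category HTop by (rule category_HTop)
  obtain \<phi> where \<phi>: "FASO_refines \<epsilon> \<delta> \<phi>"
    using FASO_refines_exists assms(2-4) by blast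
  obtain \<psi> where \<psi>: "FASO_refines \<delta> \<epsilon> \<psi>"
    using FASO_refines_exists assms(2-4) by blast
  let ?S = "FASO_system \<epsilon> A" and ?T = "FASO_system \<delta> B"
  have "sys_equiv HTop ?S ?T `` {FASO_mor \<epsilon> A \<delta> B \<phi>} \<in> Hom (Pro HTop) ?S ?T"
    "sys_equiv HTop ?T ?S `` {FASO_mor \<delta> B \<epsilon> A \<psi>} \<in> Hom (Pro HTop) ?T ?S"
    using FASO_mor_in[OF assms(2,3,4) \<phi>] FASO_mor_in[OF assms(2,4,3) \<psi>] unfolding Hom_Pro by blast+
  moreover have "?S \<in> Obj (Pro HTop)" "?T \<in> Obj (Pro HTop)"
    using inverse_system_FASO assms(2-4) by (auto simp: Pro_def)
  ultimately show ?thesis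
    unfolding isomorphic_def
    using Compose_FASO_mor[OF assms(2,3,4) \<phi> \<psi>] Compose_FASO_mor[OF assms(2,4,3) \<psi> \<phi>] by blast
qed

end
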